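(* Any (possibly randomized) $\alpha$-approximation CONGEST algorithm for the minimum cost $k$-edge-connected spanning subgraph ($k$-ECSS) problem in multi-graphs requires $\Omega(D+\sqrt n/\log n)$ rounds, for any polynomial $\alpha\ge 1$. The lower bound holds even in graphs with diameter $D=O(\log n)$.
   Context: CONGEST model: the communication network is the input (multi)graph $G$ with $n$ vertices and diameter $D$. Vertices have unique $O(\log n)$-bit identifiers and communicate in synchronous rounds; in each round each vertex may send an $O(\log n)$-bit message over each incident edge (each parallel edge carries its own message). Initially a vertex knows only its incident edges and their weights (non-negative integers polynomial in $n$). At the end each vertex must know which of its incident edges belong to the output subgraph. Multi-graphs may have parallel edges. A graph is $k$-edge-connected if it remains connected after the removal of any $k-1$ edges. In the minimum cost $k$-ECSS problem the goal is to find a minimum cost $k$-edge-connected spanning subgraph of a given weighted $k$-edge-connected graph $G$ (cost = sum of edge weights). An $\alpha$-approximation algorithm outputs (with high probability, i.e. at least $1-1/n^{c}$ for a constant $c\geq 1$, if randomized) a $k$-edge-connected spanning subgraph of cost at most $\alpha$ times the optimum; $\alpha=\alpha(n)$ is bounded by a polynomial in $n$. The lower bound is on the worst-case number of rounds over inputs. *)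

theory Defs
  imports "HOL-Probability.Probability" "HOL-Library.Landau_Symbols"
begin

section \<open>Weighted multigraphs\<close>

text \<open>
  Vertices are identified with their (unique) identifiers. An edge is its set of two endpoints
  together with an index that tells parallel edges apart.
\<close>

type_synonym edge = "nat set \<times> nat"

record mgraph =
  verts :: "nat set"
  edges :: "edge set"
  weight :: "edge \<Rightarrow> nat"

text \<open>
  The last conjunct makes the parallel edges between two vertices carry the indices
  \<open>0, \<dots>, m - 1\<close>, so that indices convey nothing beyond the order of the parallel edges.
\<close>

definition mgraph_wf :: "mgraph \<Rightarrow> bool" where
  "mgraph_wf G \<longleftrightarrow>
     finite (verts G) \<and> verts G \<noteq> {} \<and> finite (edges G) \<and>
     (\<forall>(S, j) \<in> edges G. S \<subseteq> verts G \<and> card S = 2) \<and>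
     (\<forall>S j. (S, Suc j) \<in> edges G \<longrightarrow> (S, j) \<in> edges G)"

definition order :: "mgraph \<Rightarrow> nat" where
  "order G = card (verts G)"

definition incident :: "mgraph \<Rightarrow> nat \<Rightarrow> edge set" where
  "incident G v = {e \<in> edges G. v \<in> fst e}"

definition adj :: "edge set \<Rightarrow> (nat \<times> nat) set" where
  "adj E = {(u, v). \<exists>j. ({u, v}, j) \<in> E}"

definition connected_on :: "nat set \<Rightarrow> edge set \<Rightarrow> bool" where
  "connected_on V E \<longleftrightarrow> (\<forall>u\<in>V. \<forall>v\<in>V. (u, v) \<in> (adj E)\<^sup>*)"

definition k_edge_connected :: "nat \<Rightarrow> nat set \<Rightarrow> edge set \<Rightarrow> bool" where
  "k_edge_connected k V E \<longleftrightarrow>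
     (\<forall>X \<subseteq> E. finite X \<and> card X \<le> k - 1 \<longrightarrow> connected_on V (E - X))"

definition hop_dist :: "mgraph \<Rightarrow> nat \<Rightarrow> nat \<Rightarrow> nat" where
  "hop_dist G u v = (LEAST l. (u, v) \<in> adj (edges G) ^^ l)"

definition diameter :: "mgraph \<Rightarrow> nat" where
  "diameter G = Max ((\<lambda>(u, v). hop_dist G u v) ` (verts G \<times> verts G))"


section \<open>Minimum cost k-edge-connected spanning subgraphs\<close>

definition cost :: "mgraph \<Rightarrow> edge set \<Rightarrow> nat" where
  "cost G F = sum (weight G) F"

definition k_ecss :: "nat \<Rightarrow> mgraph \<Rightarrow> edge set \<Rightarrow> bool" where
  "k_ecss k G F \<longleftrightarrow> F \<subseteq> edges G \<and> k_edge_connected k (verts G) F"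

definition opt_cost :: "nat \<Rightarrow> mgraph \<Rightarrow> nat" where
  "opt_cost k G = Min (cost G ` {F. k_ecss k G F})"

text \<open>
  The inputs: \<open>k\<close>-edge-connected multigraphs on \<open>n\<close> vertices with identifiers of
  \<open>O(log n)\<close> bits (below \<open>n ^ a\<close>) and weights polynomial in \<open>n\<close> (at most \<open>n ^ b\<close>).
\<close>

definition kecss_inputs :: "nat \<Rightarrow> nat \<Rightarrow> nat \<Rightarrow> mgraph set" where
  "kecss_inputs k a b =
     {G. mgraph_wf G \<and> k_edge_connected k (verts G) (edges G) \<and>
         (\<forall>v \<in> verts G. v < order G ^ a) \<and>
         (\<forall>e \<in> edges G. weight G e \<le> order G ^ b)}"


section \<open>The CONGEST model\<close>

text \<open>
  An algorithm is one state machine, executed by every vertex. The initial state is drawn from the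
  identifier of the vertex and the partial map sending its incident edges to their weights. In each
  round a vertex puts a bit string on each incident edge (the empty one meaning no message), and
  draws its next state from its state and the bit strings received. Randomness is private: given
  the global configuration, all vertices draw independently. A state \<open>s\<close> with
  \<open>output A s = Some X\<close> is terminal, and \<open>X\<close> is the set of incident edges the vertex outputs.
\<close>

record 's congest_alg =
  init :: "nat \<Rightarrow> (edge \<rightharpoonup> nat) \<Rightarrow> 's pmf"
  send :: "'s \<Rightarrow> edge \<Rightarrow> bool list"
  "next" :: "'s \<Rightarrow> (edge \<Rightarrow> bool list) \<Rightarrow> 's pmf"
  "output" :: "'s \<Rightarrow> edge set option"

definition local_view :: "mgraph \<Rightarrow> nat \<Rightarrow> (edge \<rightharpoonup> nat)" where
  "local_view G v = (\<lambda>e. Some (weight G e)) |` incident G v"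

definition msg :: "'s congest_alg \<Rightarrow> 's \<Rightarrow> edge \<Rightarrow> bool list" where
  "msg A s e = (if output A s = None then send A s e else [])"

definition inbox :: "'s congest_alg \<Rightarrow> mgraph \<Rightarrow> (nat \<Rightarrow> 's) \<Rightarrow> nat \<Rightarrow> edge \<Rightarrow> bool list" where
  "inbox A G \<sigma> v e =
     (if e \<in> incident G v then msg A (\<sigma> (the_elem (fst e - {v}))) e else [])"

definition vertex_step :: "'s congest_alg \<Rightarrow> mgraph \<Rightarrow> (nat \<Rightarrow> 's) \<Rightarrow> nat \<Rightarrow> 's pmf" where
  "vertex_step A G \<sigma> v =
     (if output A (\<sigma> v) = None then next A (\<sigma> v) (inbox A G \<sigma> v) else return_pmf (\<sigma> v))"

text \<open>The distribution of the global configuration after a number of rounds.\<close>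

primrec run :: "'s congest_alg \<Rightarrow> mgraph \<Rightarrow> nat \<Rightarrow> (nat \<Rightarrow> 's) pmf" where
  "run A G 0 = Pi_pmf (verts G) undefined (\<lambda>v. init A v (local_view G v))"
| "run A G (Suc t) = run A G t \<bind> (\<lambda>\<sigma>. Pi_pmf (verts G) undefined (vertex_step A G \<sigma>))"

definition respects_bandwidth :: "real \<Rightarrow> mgraph set \<Rightarrow> 's congest_alg \<Rightarrow> bool" where
  "respects_bandwidth \<beta> \<G> A \<longleftrightarrow>
     (\<forall>G \<in> \<G>. \<forall>t. \<forall>\<sigma> \<in> set_pmf (run A G t). \<forall>v \<in> verts G. \<forall>e \<in> incident G v.
        real (length (msg A (\<sigma> v) e)) \<le> \<beta> * log 2 (real (order G)))"

definition terminated :: "'s congest_alg \<Rightarrow> mgraph \<Rightarrow> (nat \<Rightarrow> 's) \<Rightarrow> bool" where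
  "terminated A G \<sigma> \<longleftrightarrow> (\<forall>v \<in> verts G. output A (\<sigma> v) \<noteq> None)"

definition outputs :: "'s congest_alg \<Rightarrow> mgraph \<Rightarrow> (nat \<Rightarrow> 's) \<Rightarrow> edge set \<Rightarrow> bool" where
  "outputs A G \<sigma> F \<longleftrightarrow> (\<forall>v \<in> verts G. output A (\<sigma> v) = Some (F \<inter> incident G v))"

definition high_prob :: "real \<Rightarrow> mgraph \<Rightarrow> real" where
  "high_prob c G = 1 - 1 / real (order G) powr c"

text \<open>
  As terminal states never change, the event below is monotone in \<open>t\<close>; the supremum is the
  probability that the execution ever terminates with an admissible output.
\<close>

definition kecss_approx_alg ::
    "nat \<Rightarrow> (nat \<Rightarrow> real) \<Rightarrow> real \<Rightarrow> mgraph set \<Rightarrow> 's congest_alg \<Rightarrow> bool" where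
  "kecss_approx_alg k \<alpha> c \<G> A \<longleftrightarrow>
     (\<forall>G \<in> \<G>. high_prob c G \<le>
        (SUP t. measure_pmf.prob (run A G t)
           {\<sigma>. \<exists>F. outputs A G \<sigma> F \<and> k_ecss k G F \<and>
                   real (cost G F) \<le> \<alpha> (order G) * real (opt_cost k G)}))"

text \<open>
  The number of rounds within which the algorithm terminates with high probability
  (\<open>\<infinity>\<close> if there is none).
\<close>

definition rounds :: "real \<Rightarrow> 's congest_alg \<Rightarrow> mgraph \<Rightarrow> enat" where
  "rounds c A G =
     Inf {enat t | t. high_prob c G \<le> measure_pmf.prob (run A G t) {\<sigma>. terminated A G \<sigma>}}"

definition worst_case_rounds ::
    "real \<Rightarrow> mgraph set \<Rightarrow> 's congest_alg \<Rightarrow> nat \<Rightarrow> nat \<Rightarrow> enat" where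
  "worst_case_rounds c \<G> A n D =
     (SUP G \<in> {G \<in> \<G>. order G = n \<and> diameter G = D}. rounds c A G)"

end

theory Submission
  imports Defs "HOL-Real_Asymp.Real_Asymp"
begin

text \<open>
  With weights in \<open>{0, 1}\<close> every approximation algorithm must decide whether the edges of weight 0
  form a \<open>k\<close>-edge-connected subgraph, as then it may not output any edge of weight 1. In the
  instances this happens iff the inner product modulo 2 of two sets \<open>x\<close> and \<open>y\<close> vanishes, where \<open>x\<close>
  and \<open>y\<close> only influence the weights at the two ends of a bundle of long columns. The only fast
  connection between the ends is a binary tree above the columns, and as long as the information
  flowing along the columns has not reached the middle, a run of \<open>T\<close> rounds is simulated by two
  parties who exchange \<open>O(T k log\<^sup>2 n)\<close> bits: the probability that no edge of weight 1 is output is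
  \<open>2 ^ O(T k log\<^sup>2 n)\<close> times a mixture of products \<open>a(x) b(y)\<close>. By Lindsey's lemma such a function does
  not correlate with the inner product unless \<open>T k log\<^sup>2 n\<close> is of the order of the number of columns.
  The bound in \<open>D\<close> is the special case of long columns without a tree, where no bits are exchanged.
\<close>

section \<open>The discrepancy of the inner product function\<close>

definition ip_sign :: "'a set \<Rightarrow> 'a set \<Rightarrow> real" where
  "ip_sign x y = (- 1) ^ card (x \<inter> y)"

lemma sum_Pow_insert:
  fixes f :: "'a set \<Rightarrow> 'b::comm_monoid_add"
  assumes "finite S" "i \<notin> S"
  shows "(\<Sum>x\<in>Pow (insert i S). f x) = (\<Sum>x\<in>Pow S. f x) + (\<Sum>x\<in>Pow S. f (insert i x))"
proof -
  have "inj_on (insert i) (Pow S)"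
    using assms(2) by (auto simp: inj_on_def)
  moreover have "Pow S \<inter> insert i ` Pow S = {}"
    using assms(2) by auto
  ultimately show ?thesis
    using assms(1) by (simp add: Pow_insert sum.union_disjoint sum.reindex)
qed

lemma ip_sign_parseval:
  fixes b :: "'a set \<Rightarrow> real"
  assumes "finite S"
  shows "(\<Sum>x\<in>Pow S. (\<Sum>y\<in>Pow S. ip_sign x y * b y)\<^sup>2) = 2 ^ card S * (\<Sum>y\<in>Pow S. (b y)\<^sup>2)"
  using assms
proof (induction S arbitrary: b rule: finite_induct)
  case empty
  show ?case by (simp add: ip_sign_def)
next
  case (insert i S)
  define B0 where "B0 x = (\<Sum>y\<in>Pow S. ip_sign x y * b y)" for x
  define B1 where "B1 x = (\<Sum>y\<in>Pow S. ip_sign x y * b (insert i y))" for x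
  have s: "ip_sign x (insert i y) = ip_sign x y" "ip_sign (insert i x) y = ip_sign x y"
    "ip_sign (insert i x) (insert i y) = - ip_sign x y" if "x \<in> Pow S" "y \<in> Pow S" for x y
  proof -
    have "i \<notin> x" "i \<notin> y" "finite (x \<inter> y)"
      using that insert.hyps by (auto intro: finite_subset[of _ S])
    then show "ip_sign x (insert i y) = ip_sign x y" "ip_sign (insert i x) y = ip_sign x y"
      "ip_sign (insert i x) (insert i y) = - ip_sign x y"
      by (simp_all add: ip_sign_def)
  qed
  have a: "(\<Sum>y\<in>Pow (insert i S). ip_sign x y * b y) = B0 x + B1 x" if "x \<in> Pow S" for x
    using insert.hyps that s unfolding B0_def B1_def
    by (subst sum_Pow_insert) (auto intro!: arg_cong2[where f="(+)"] sum.cong)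
  have b: "(\<Sum>y\<in>Pow (insert i S). ip_sign (insert i x) y * b y) = B0 x - B1 x" if "x \<in> Pow S" for x
    using insert.hyps that s unfolding B0_def B1_def diff_conv_add_uminus sum_negf[symmetric]
    by (subst sum_Pow_insert) (auto intro!: arg_cong2[where f="(+)"] sum.cong)
  have "(\<Sum>x\<in>Pow (insert i S). (\<Sum>y\<in>Pow (insert i S). ip_sign x y * b y)\<^sup>2)
      = (\<Sum>x\<in>Pow S. (B0 x + B1 x)\<^sup>2) + (\<Sum>x\<in>Pow S. (B0 x - B1 x)\<^sup>2)"
    by (intro trans[OF sum_Pow_insert[OF insert.hyps]] arg_cong2[where f="(+)"] sum.cong refl)
      (simp_all only: a b)
  also have "\<dots> = (\<Sum>x\<in>Pow S. 2 * (B0 x)\<^sup>2 + 2 * (B1 x)\<^sup>2)"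
    by (simp add: sum.distrib[symmetric] power2_eq_square algebra_simps)
  also have "\<dots> = 2 * (\<Sum>x\<in>Pow S. (B0 x)\<^sup>2) + 2 * (\<Sum>x\<in>Pow S. (B1 x)\<^sup>2)"
    by (simp add: sum.distrib sum_distrib_left)
  also have "\<dots> = 2 ^ card (insert i S) * (\<Sum>y\<in>Pow (insert i S). (b y)\<^sup>2)"
    using insert.hyps unfolding B0_def B1_def
    by (simp add: insert.IH sum_Pow_insert distrib_left)
  finally show ?case .
qed

lemma ip_discrepancy:
  fixes a b :: "'a set \<Rightarrow> real"
  assumes "finite S" and a: "\<And>x. \<bar>a x\<bar> \<le> 1" and b: "\<And>y. \<bar>b y\<bar> \<le> 1"
  shows "\<bar>\<Sum>x\<in>Pow S. \<Sum>y\<in>Pow S. ip_sign x y * (a x * b y)\<bar> \<le> 2 ^ card S * sqrt (2 ^ card S)"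
proof -
  have le: "(\<Sum>x\<in>Pow S. (c x)\<^sup>2) \<le> 2 ^ card S" if "\<And>x. \<bar>c x\<bar> \<le> 1" for c :: "'a set \<Rightarrow> real"
  proof -
    have "(\<Sum>x\<in>Pow S. (c x)\<^sup>2) \<le> (\<Sum>x\<in>Pow S. 1)"
      using that by (intro sum_mono) (simp add: abs_square_le_1)
    then show ?thesis using assms(1) by (simp add: card_Pow)
  qed
  have "(\<Sum>x\<in>Pow S. \<Sum>y\<in>Pow S. ip_sign x y * (a x * b y))
      = (\<Sum>x\<in>Pow S. a x * (\<Sum>y\<in>Pow S. ip_sign x y * b y))"
    by (simp add: sum_distrib_left mult_ac)
  then have "(\<Sum>x\<in>Pow S. \<Sum>y\<in>Pow S. ip_sign x y * (a x * b y))\<^sup>2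
      \<le> (\<Sum>x\<in>Pow S. (a x)\<^sup>2) * (\<Sum>x\<in>Pow S. (\<Sum>y\<in>Pow S. ip_sign x y * b y)\<^sup>2)"
    by (simp only: Cauchy_Schwarz_ineq_sum)
  also have "\<dots> \<le> 2 ^ card S * (2 ^ card S * 2 ^ card S)"
    using ip_sign_parseval[OF assms(1)] le[of a, OF a] le[of b, OF b]
    by (intro mult_mono) (auto intro!: mult_nonneg_nonneg sum_nonneg)
  also have "\<dots> = (2 ^ card S * sqrt (2 ^ card S))\<^sup>2"
    by (simp add: power2_eq_square)
  finally show ?thesis
    by (rule abs_le_square_iff[THEN iffD2, THEN order_trans]) simp
qed

section \<open>Mixtures of rectangles\<close>

definition agree :: "'v set \<Rightarrow> ('v \<Rightarrow> 's) \<Rightarrow> ('v \<Rightarrow> 's) \<Rightarrow> bool" where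
  "agree S \<sigma> \<sigma>' \<longleftrightarrow> (\<forall>v\<in>S. \<sigma> v = \<sigma>' v)"

lemma agree_refl [simp]: "agree S \<sigma> \<sigma>"
  and agree_empty [simp]: "agree {} \<sigma> \<sigma>'"
  by (auto simp: agree_def)

definition local_factor :: "'v set \<Rightarrow> ('x \<Rightarrow> ('v \<Rightarrow> 's) \<Rightarrow> ennreal) \<Rightarrow> bool" where
  "local_factor A a \<longleftrightarrow> (\<forall>x \<sigma>. a x \<sigma> \<le> 1) \<and> (\<forall>x \<sigma> \<sigma>'. agree A \<sigma> \<sigma>' \<longrightarrow> a x \<sigma> = a x \<sigma>')"

text \<open>
  Alice knows \<open>x\<close> and the states on \<open>A\<close>, Bob knows \<open>y\<close> and the states on \<open>B\<close>. Once the states on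
  the common part \<open>A \<inter> B\<close> are fixed, \<open>F\<close> is \<open>C\<close> times a mixture of products of an Alice factor
  and a Bob factor; the mixture may depend on the common part but neither on \<open>x\<close> nor on \<open>y\<close>.
\<close>

definition rect_mixture ::
    "nat \<Rightarrow> 'v set \<Rightarrow> 'v set \<Rightarrow> ('x \<Rightarrow> 'y \<Rightarrow> ('v \<Rightarrow> 's) \<Rightarrow> ennreal) \<Rightarrow> bool" where
  "rect_mixture C A B F \<longleftrightarrow>
     (\<forall>m. \<exists>p. (\<forall>(a, b)\<in>set_pmf p. local_factor A a \<and> local_factor B b) \<and>
       (\<forall>x y \<sigma>. agree (A \<inter> B) \<sigma> m \<longrightarrow>
          F x y \<sigma> = of_nat C * (\<integral>\<^sup>+(a, b). a x \<sigma> * b y \<sigma> \<partial>measure_pmf p)))"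

lemma rect_mixture_product:
  assumes "local_factor A a" "local_factor B b"
  shows "rect_mixture 1 A B (\<lambda>x y \<sigma>. a x \<sigma> * b y \<sigma>)"
  unfolding rect_mixture_def
  by (intro allI exI[of _ "return_pmf (a, b)"]) (use assms in simp)

lemma nn_integral_pmf_commute:
  "(\<integral>\<^sup>+x. \<integral>\<^sup>+y. f x y \<partial>measure_pmf q \<partial>measure_pmf p) = (\<integral>\<^sup>+y. \<integral>\<^sup>+x. f x y \<partial>measure_pmf p \<partial>measure_pmf q)"
proof -
  have "(\<integral>\<^sup>+z. case_prod f z \<partial>bind_pmf p (\<lambda>x. bind_pmf q (\<lambda>y. return_pmf (x, y))))
      = (\<integral>\<^sup>+z. case_prod f z \<partial>bind_pmf q (\<lambda>y. bind_pmf p (\<lambda>x. return_pmf (x, y))))"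
    by (subst bind_commute_pmf) rule
  then show ?thesis by simp
qed

lemma nn_integral_pmf_le_1:
  assumes "\<And>x. f x \<le> 1"
  shows "(\<integral>\<^sup>+x. f x \<partial>measure_pmf p) \<le> 1"
proof -
  have "(\<integral>\<^sup>+x. f x \<partial>measure_pmf p) \<le> (\<integral>\<^sup>+x. 1 \<partial>measure_pmf p)"
    using assms by (intro nn_integral_mono)
  then show ?thesis by simp
qed

lemma nn_integral_Pi_pmf_union:
  assumes "finite A" "finite B" "A \<inter> B = {}"
  shows "(\<integral>\<^sup>+\<sigma>. f \<sigma> \<partial>measure_pmf (Pi_pmf (A \<union> B) dflt p))
    = (\<integral>\<^sup>+g. \<integral>\<^sup>+h. f (\<lambda>v. if v \<in> A then g v else h v) \<partial>Pi_pmf B dflt p \<partial>Pi_pmf A dflt p)"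
  using assms by (simp add: Pi_pmf_union nn_integral_pair_pmf')

text \<open>
  Guessing both transcripts uniformly costs the factor \<open>card Q * card Q'\<close>. Given the guess, the
  new states of the common part can be drawn jointly, and each side checks the messages that it
  sends itself.
\<close>

lemma rect_mixture_step:
  fixes K :: "'x \<Rightarrow> 'y \<Rightarrow> ('v \<Rightarrow> 's) \<Rightarrow> 'v \<Rightarrow> 's pmf"
    and F :: "'x \<Rightarrow> 'y \<Rightarrow> ('v \<Rightarrow> 's) \<Rightarrow> ennreal"
  assumes F: "rect_mixture C A' B' F"
    and V: "finite V" "V = A' \<union> B'"
    and Q: "finite Q" "Q \<noteq> {}" "finite Q'" "Q' \<noteq> {}"
    and rho: "\<And>y \<sigma>. \<rho> y \<sigma> \<in> Q" "\<And>y \<sigma> \<sigma>'. agree B \<sigma> \<sigma>' \<Longrightarrow> \<rho> y \<sigma> = \<rho> y \<sigma>'"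
    and lam: "\<And>x \<sigma>. \<mu> x \<sigma> \<in> Q'" "\<And>x \<sigma> \<sigma>'. agree A \<sigma> \<sigma>' \<Longrightarrow> \<mu> x \<sigma> = \<mu> x \<sigma>'"
    and KA: "\<And>x y \<sigma> v. v \<in> A' \<Longrightarrow> K x y \<sigma> v = KA x \<sigma> (\<rho> y \<sigma>) v"
      "\<And>x \<sigma> \<sigma>' r v. v \<in> A' \<Longrightarrow> agree A \<sigma> \<sigma>' \<Longrightarrow> KA x \<sigma> r v = KA x \<sigma>' r v"
    and KB: "\<And>x y \<sigma> v. v \<in> B' \<Longrightarrow> K x y \<sigma> v = KB y \<sigma> (\<mu> x \<sigma>) v"
      "\<And>y \<sigma> \<sigma>' r v. v \<in> B' \<Longrightarrow> agree B \<sigma> \<sigma>' \<Longrightarrow> KB y \<sigma> r v = KB y \<sigma>' r v"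
  shows "rect_mixture (C * (card Q * card Q')) A B
           (\<lambda>x y \<sigma>. \<integral>\<^sup>+\<sigma>'. F x y \<sigma>' \<partial>measure_pmf (Pi_pmf V dflt (K x y \<sigma>)))"
  unfolding rect_mixture_def
proof
  fix m :: "'v \<Rightarrow> 's"
  define M where "M = A' \<inter> B'"
  define L where "L = A' - B'"
  define R where "R = B' - A'"
  have fin: "finite M" "finite L" "finite R" "M \<inter> (L \<union> R) = {}" "L \<inter> R = {}" "V = M \<union> (L \<union> R)"
    using V by (auto simp: M_def L_def R_def)
  define mrg where "mrg S g h = (\<lambda>v. if v \<in> S then g v else h v)"
    for S :: "'v set" and g h :: "'v \<Rightarrow> 's"
  obtain P where P: "\<And>m'. \<forall>(a, b)\<in>set_pmf (P m'). local_factor A' a \<and> local_factor B' b"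
    "\<And>m' x y \<sigma>. agree (A' \<inter> B') \<sigma> m' \<Longrightarrow>
       F x y \<sigma> = of_nat C * (\<integral>\<^sup>+(a, b). a x \<sigma> * b y \<sigma> \<partial>measure_pmf (P m'))"
    using F unfolding rect_mixture_def by metis
  define ok where "ok r l = (\<lambda>(x, y, \<sigma>). agree (A \<inter> B) \<sigma> m \<and> \<rho> y \<sigma> = r \<and> \<mu> x \<sigma> = l)" for r l
  define \<kappa> where "\<kappa> r l = (case SOME z. ok r l z of (x, y, \<sigma>) \<Rightarrow> Pi_pmf M dflt (K x y \<sigma>))" for r l
  have K_common: "K x1 y1 \<sigma>1 v = K x2 y2 \<sigma>2 v"
    if "ok r l (x1, y1, \<sigma>1)" "ok r l (x2, y2, \<sigma>2)" "v \<in> M" for r l x1 y1 \<sigma>1 x2 y2 \<sigma>2 v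
  proof -
    define \<sigma>3 where "\<sigma>3 = mrg A \<sigma>1 \<sigma>2"
    have A: "agree A \<sigma>1 \<sigma>3" and B: "agree B \<sigma>3 \<sigma>2"
      using that(1,2) by (auto simp: agree_def \<sigma>3_def mrg_def ok_def)
    have v: "v \<in> A'" "v \<in> B'" using that(3) by (auto simp: M_def)
    have r: "\<rho> y2 \<sigma>3 = r" "\<mu> x1 \<sigma>3 = l"
      using rho(2)[OF B] lam(2)[OF A] that(1,2) by (auto simp: ok_def)
    have "K x1 y1 \<sigma>1 v = K x1 y2 \<sigma>3 v"
      using KA(1)[OF v(1)] KA(2)[OF v(1) A] r that(1,2) by (simp add: ok_def)
    also have "\<dots> = K x2 y2 \<sigma>2 v"
      using KB(1)[OF v(2)] KB(2)[OF v(2) B] r that(1,2) by (simp add: ok_def)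
    finally show ?thesis .
  qed
  have \<kappa>_eq: "\<kappa> (\<rho> y \<sigma>) (\<mu> x \<sigma>) = Pi_pmf M dflt (K x y \<sigma>)" if "agree (A \<inter> B) \<sigma> m" for x y \<sigma>
  proof -
    have ok: "ok (\<rho> y \<sigma>) (\<mu> x \<sigma>) (x, y, \<sigma>)" using that by (simp add: ok_def)
    then have "ok (\<rho> y \<sigma>) (\<mu> x \<sigma>) (SOME z. ok (\<rho> y \<sigma>) (\<mu> x \<sigma>) z)" by (rule someI)
    then show ?thesis
      unfolding \<kappa>_def using K_common[OF _ ok]
      by (auto split: prod.splits intro!: Pi_pmf_cong)
  qed
  define liftA where "liftA r l m' a x \<sigma> = (if \<mu> x \<sigma> = l then
      (\<integral>\<^sup>+g. a x (mrg M m' g) \<partial>measure_pmf (Pi_pmf L dflt (KA x \<sigma> r))) else 0)"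
    for r l m' and a :: "'x \<Rightarrow> ('v \<Rightarrow> 's) \<Rightarrow> ennreal" and x \<sigma>
  define liftB where "liftB r l m' b y \<sigma> = (if \<rho> y \<sigma> = r then
      (\<integral>\<^sup>+h. b y (mrg M m' h) \<partial>measure_pmf (Pi_pmf R dflt (KB y \<sigma> l))) else 0)"
    for r l m' and b :: "'y \<Rightarrow> ('v \<Rightarrow> 's) \<Rightarrow> ennreal" and y \<sigma>
  define p where "p = bind_pmf (pmf_of_set (Q \<times> Q')) (\<lambda>(r, l). bind_pmf (\<kappa> r l) (\<lambda>m'.
      map_pmf (\<lambda>(a, b). (liftA r l m' a, liftB r l m' b)) (P m')))"
  have lfA: "local_factor A (liftA r l m' a)" if "local_factor A' a" for r l m' a
  proof -
    have "Pi_pmf L dflt (KA x \<sigma> r) = Pi_pmf L dflt (KA x \<sigma>' r)" if "agree A \<sigma> \<sigma>'" for x \<sigma> \<sigma>'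
      by (intro Pi_pmf_cong refl KA(2) that) (simp add: L_def)
    then show ?thesis
      using that lam(2) unfolding local_factor_def liftA_def
      by (auto intro!: nn_integral_pmf_le_1)
  qed
  have lfB: "local_factor B (liftB r l m' b)" if "local_factor B' b" for r l m' b
  proof -
    have "Pi_pmf R dflt (KB y \<sigma> l) = Pi_pmf R dflt (KB y \<sigma>' l)" if "agree B \<sigma> \<sigma>'" for y \<sigma> \<sigma>'
      by (intro Pi_pmf_cong refl KB(2) that) (simp add: R_def)
    then show ?thesis
      using that rho(2) unfolding local_factor_def liftB_def
      by (auto intro!: nn_integral_pmf_le_1)
  qed
  have "(\<integral>\<^sup>+\<sigma>'. F x y \<sigma>' \<partial>measure_pmf (Pi_pmf V dflt (K x y \<sigma>)))
      = of_nat (C * (card Q * card Q')) * (\<integral>\<^sup>+(a, b). a x \<sigma> * b y \<sigma> \<partial>measure_pmf p)"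
    if ag: "agree (A \<inter> B) \<sigma> m" for x y \<sigma>
  proof -
    define r0 where "r0 = \<rho> y \<sigma>"
    define l0 where "l0 = \<mu> x \<sigma>"
    define N where "N = (\<integral>\<^sup>+m'. \<integral>\<^sup>+(a, b). liftA r0 l0 m' a x \<sigma> * liftB r0 l0 m' b y \<sigma>
        \<partial>measure_pmf (P m') \<partial>measure_pmf (Pi_pmf M dflt (K x y \<sigma>)))"
    have mem: "(r0, l0) \<in> Q \<times> Q'" using rho lam by (simp add: r0_def l0_def)
    have card0: "card (Q \<times> Q') \<noteq> 0" using Q by auto
    have z: "(\<integral>\<^sup>+m'. \<integral>\<^sup>+(a, b). liftA r l m' a x \<sigma> * liftB r l m' b y \<sigma>
        \<partial>measure_pmf (P m') \<partial>measure_pmf (\<kappa> r l)) = (if (r, l) = (r0, l0) then N else 0)" for r l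
      using \<kappa>_eq[OF ag] by (auto simp: N_def r0_def l0_def liftA_def liftB_def case_prod_unfold)
    have "(\<integral>\<^sup>+(a, b). a x \<sigma> * b y \<sigma> \<partial>measure_pmf p)
        = (\<Sum>(r, l)\<in>Q \<times> Q'. \<integral>\<^sup>+m'. \<integral>\<^sup>+(a, b). liftA r l m' a x \<sigma> * liftB r l m' b y \<sigma>
              \<partial>measure_pmf (P m') \<partial>measure_pmf (\<kappa> r l)) / card (Q \<times> Q')"
      using Q by (simp add: p_def nn_integral_pmf_of_set case_prod_unfold)
    also have "\<dots> = N / card (Q \<times> Q')"
    proof -
      have "(\<Sum>(r, l)\<in>Q \<times> Q'. \<integral>\<^sup>+m'. \<integral>\<^sup>+(a, b). liftA r l m' a x \<sigma> * liftB r l m' b y \<sigma>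
          \<partial>measure_pmf (P m') \<partial>measure_pmf (\<kappa> r l)) = (\<Sum>w\<in>Q \<times> Q'. if w = (r0, l0) then N else 0)"
        by (intro sum.cong refl) (simp only: z split_beta prod.collapse)
      also have "\<dots> = N" using mem Q by (subst sum.delta) auto
      finally show ?thesis by simp
    qed
    finally have 1: "(\<integral>\<^sup>+(a, b). a x \<sigma> * b y \<sigma> \<partial>measure_pmf p) = N / card (Q \<times> Q')" .
    have KA0: "Pi_pmf L dflt (K x y \<sigma>) = Pi_pmf L dflt (KA x \<sigma> r0)"
      by (intro Pi_pmf_cong refl) (simp add: KA(1) L_def r0_def)
    have KB0: "Pi_pmf R dflt (K x y \<sigma>) = Pi_pmf R dflt (KB y \<sigma> l0)"
      by (intro Pi_pmf_cong refl) (simp add: KB(1) R_def l0_def)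
    have Fm: "F x y (mrg M m' (mrg L g h)) = of_nat C * (\<integral>\<^sup>+(a, b). a x (mrg M m' g) * b y (mrg M m' h) \<partial>measure_pmf (P m'))"
      for m' g h
    proof -
      have "F x y (mrg M m' (mrg L g h)) = of_nat C *
          (\<integral>\<^sup>+(a, b). a x (mrg M m' (mrg L g h)) * b y (mrg M m' (mrg L g h)) \<partial>measure_pmf (P m'))"
        by (intro P(2)) (simp add: agree_def mrg_def M_def)
      also have "(\<integral>\<^sup>+(a, b). a x (mrg M m' (mrg L g h)) * b y (mrg M m' (mrg L g h)) \<partial>measure_pmf (P m'))
          = (\<integral>\<^sup>+(a, b). a x (mrg M m' g) * b y (mrg M m' h) \<partial>measure_pmf (P m'))"
      proof (intro nn_integral_cong_AE AE_pmfI)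
        fix z assume "z \<in> set_pmf (P m')"
        moreover obtain a b where z: "z = (a, b)" by (cases z)
        ultimately have "local_factor A' a" "local_factor B' b" using P(1)[of m'] by auto
        moreover have "agree A' (mrg M m' (mrg L g h)) (mrg M m' g)"
          "agree B' (mrg M m' (mrg L g h)) (mrg M m' h)"
          by (auto simp: agree_def mrg_def M_def L_def)
        ultimately have "a x (mrg M m' (mrg L g h)) = a x (mrg M m' g)"
          "b y (mrg M m' (mrg L g h)) = b y (mrg M m' h)"
          unfolding local_factor_def by blast+
        then show "(case z of (a, b) \<Rightarrow> a x (mrg M m' (mrg L g h)) * b y (mrg M m' (mrg L g h)))
          = (case z of (a, b) \<Rightarrow> a x (mrg M m' g) * b y (mrg M m' h))"
          by (simp add: z)
      qed
      finally show ?thesis .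
    qed
    have "(\<integral>\<^sup>+\<sigma>'. F x y \<sigma>' \<partial>measure_pmf (Pi_pmf V dflt (K x y \<sigma>)))
        = (\<integral>\<^sup>+m'. \<integral>\<^sup>+g. \<integral>\<^sup>+h. F x y (mrg M m' (mrg L g h)) \<partial>Pi_pmf R dflt (K x y \<sigma>)
            \<partial>Pi_pmf L dflt (K x y \<sigma>) \<partial>Pi_pmf M dflt (K x y \<sigma>))"
      using fin by (simp add: nn_integral_Pi_pmf_union mrg_def)
    also have "\<dots> = (\<integral>\<^sup>+m'. of_nat C * (\<integral>\<^sup>+(a, b). liftA r0 l0 m' a x \<sigma> * liftB r0 l0 m' b y \<sigma>
        \<partial>measure_pmf (P m')) \<partial>measure_pmf (Pi_pmf M dflt (K x y \<sigma>)))"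
    proof (intro nn_integral_cong)
      fix m'
      let ?L = "measure_pmf (Pi_pmf L dflt (KA x \<sigma> r0))" and ?R = "measure_pmf (Pi_pmf R dflt (KB y \<sigma> l0))"
      have "(\<integral>\<^sup>+g. \<integral>\<^sup>+h. F x y (mrg M m' (mrg L g h)) \<partial>?R \<partial>?L)
          = of_nat C * (\<integral>\<^sup>+g. \<integral>\<^sup>+h. \<integral>\<^sup>+z. fst z x (mrg M m' g) * snd z y (mrg M m' h) \<partial>measure_pmf (P m') \<partial>?R \<partial>?L)"
        by (simp add: Fm nn_integral_cmult case_prod_unfold)
      also have "(\<integral>\<^sup>+g. \<integral>\<^sup>+h. \<integral>\<^sup>+z. fst z x (mrg M m' g) * snd z y (mrg M m' h) \<partial>measure_pmf (P m') \<partial>?R \<partial>?L)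
          = (\<integral>\<^sup>+z. \<integral>\<^sup>+g. \<integral>\<^sup>+h. fst z x (mrg M m' g) * snd z y (mrg M m' h) \<partial>?R \<partial>?L \<partial>measure_pmf (P m'))"
        by (subst nn_integral_pmf_commute, subst nn_integral_pmf_commute[of _ "P m'"]) rule
      also have "\<dots> = (\<integral>\<^sup>+(a, b). liftA r0 l0 m' a x \<sigma> * liftB r0 l0 m' b y \<sigma> \<partial>measure_pmf (P m'))"
        by (simp add: nn_integral_cmult nn_integral_multc liftA_def liftB_def case_prod_unfold
            flip: r0_def l0_def)
      finally show "(\<integral>\<^sup>+g. \<integral>\<^sup>+h. F x y (mrg M m' (mrg L g h)) \<partial>Pi_pmf R dflt (K x y \<sigma>) \<partial>Pi_pmf L dflt (K x y \<sigma>))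
        = of_nat C * (\<integral>\<^sup>+(a, b). liftA r0 l0 m' a x \<sigma> * liftB r0 l0 m' b y \<sigma> \<partial>measure_pmf (P m'))"
        by (simp only: KA0 KB0)
    qed
    also have "\<dots> = of_nat C * N" by (simp add: nn_integral_cmult N_def)
    also have "\<dots> = of_nat (C * (card Q * card Q')) * (N / card (Q \<times> Q'))"
    proof -
      have "of_nat (card (Q \<times> Q')) * (N / of_nat (card (Q \<times> Q'))) = N"
        using card0 by (simp add: ennreal_times_divide mult_divide_eq_ennreal mult.commute)
      then show ?thesis by (simp add: mult.assoc card_cartesian_product)
    qed
    finally show ?thesis unfolding 1 .
  qed
  moreover have "\<forall>(a, b)\<in>set_pmf p. local_factor A a \<and> local_factor B b"
    using P(1) lfA lfB unfolding p_def by fastforce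
  ultimately show "\<exists>p. (\<forall>(a, b)\<in>set_pmf p. local_factor A a \<and> local_factor B b) \<and>
       (\<forall>x y \<sigma>. agree (A \<inter> B) \<sigma> m \<longrightarrow>
          (\<integral>\<^sup>+\<sigma>'. F x y \<sigma>' \<partial>measure_pmf (Pi_pmf V dflt (K x y \<sigma>)))
          = of_nat (C * (card Q * card Q')) * (\<integral>\<^sup>+(a, b). a x \<sigma> * b y \<sigma> \<partial>measure_pmf p))"
    by blast
qed

lemma rect_mixture_discrepancy:
  fixes P :: "'a set \<Rightarrow> 'a set \<Rightarrow> real"
  assumes "rect_mixture C {} {} (\<lambda>x y (\<sigma> :: 'v \<Rightarrow> 's). ennreal (P x y))" "\<And>x y. P x y \<ge> 0" "finite S"
  shows "(\<Sum>x\<in>Pow S. \<Sum>y\<in>Pow S. ip_sign x y * P x y) \<le> real C * (2 ^ card S * sqrt (2 ^ card S))"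
proof -
  define m where "m = (undefined :: 'v \<Rightarrow> 's)"
  obtain p :: "(('a set \<Rightarrow> ('v \<Rightarrow> 's) \<Rightarrow> ennreal) \<times> ('a set \<Rightarrow> ('v \<Rightarrow> 's) \<Rightarrow> ennreal)) pmf" where p: "\<forall>(a, b)\<in>set_pmf p. local_factor {} a \<and> local_factor {} b"
    "\<And>x y. ennreal (P x y) = of_nat C * (\<integral>\<^sup>+(a, b). a x m * b y m \<partial>measure_pmf p)"
    using assms(1) unfolding rect_mixture_def by fastforce
  define \<phi> where "\<phi> x y z = enn2real (fst z x m) * enn2real (snd z y m)"
    for x y and z :: "('a set \<Rightarrow> ('v \<Rightarrow> 's) \<Rightarrow> ennreal) \<times> ('a set \<Rightarrow> ('v \<Rightarrow> 's) \<Rightarrow> ennreal)"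
  have le1: "fst z x m \<le> 1" "snd z y m \<le> 1" if "z \<in> set_pmf p" for z x y
    using p(1) that by (cases z; force simp: local_factor_def)+
  have e1: "enn2real (fst z x m) \<le> 1" "enn2real (snd z y m) \<le> 1" if "z \<in> set_pmf p" for z x y
    by (intro enn2real_leI; simp add: le1[OF that])+
  have int: "integrable (measure_pmf p) (\<phi> x y)" for x y
    by (rule measure_pmf.integrable_const_bound[where B=1])
      (auto simp: AE_measure_pmf_iff \<phi>_def abs_mult intro!: mult_le_one e1)
  have P_eq: "P x y = real C * measure_pmf.expectation p (\<phi> x y)" for x y
  proof -
    have "(\<integral>\<^sup>+(a, b). a x m * b y m \<partial>measure_pmf p) = (\<integral>\<^sup>+z. ennreal (\<phi> x y z) \<partial>measure_pmf p)"
    proof (intro nn_integral_cong_AE AE_pmfI)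
      fix z assume "z \<in> set_pmf p"
      then have "fst z x m < \<top>" "snd z y m < \<top>"
        using le1 by (meson ennreal_one_less_top order_le_less_trans)+
      then show "(case z of (a, b) \<Rightarrow> a x m * b y m) = ennreal (\<phi> x y z)"
        by (simp add: \<phi>_def ennreal_mult case_prod_unfold)
    qed
    also have "\<dots> = ennreal (measure_pmf.expectation p (\<phi> x y))"
      by (intro nn_integral_eq_integral int) (simp add: \<phi>_def)
    finally have "ennreal (P x y) = ennreal (real C * measure_pmf.expectation p (\<phi> x y))"
      using p(2)[of x y] by (simp add: ennreal_mult' ennreal_of_nat_eq_real_of_nat)
    moreover have "0 \<le> measure_pmf.expectation p (\<phi> x y)"
      by (intro integral_nonneg_AE AE_pmfI) (simp add: \<phi>_def)
    ultimately show ?thesis using assms(2) by (subst (asm) ennreal_inj) auto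
  qed
  have "(\<Sum>x\<in>Pow S. \<Sum>y\<in>Pow S. ip_sign x y * P x y)
      = real C * measure_pmf.expectation p (\<lambda>z. \<Sum>x\<in>Pow S. \<Sum>y\<in>Pow S. ip_sign x y * \<phi> x y z)"
    using int by (simp add: P_eq sum_distrib_left mult_ac)
  also have "\<dots> \<le> real C * (2 ^ card S * sqrt (2 ^ card S))"
  proof (intro mult_left_mono measure_pmf.integral_le_const AE_pmfI)
    fix z assume z: "z \<in> set_pmf p"
    have "\<bar>enn2real (fst z x m)\<bar> \<le> 1" "\<bar>enn2real (snd z y m)\<bar> \<le> 1" for x y
      using e1[OF z] by auto
    from ip_discrepancy[where a="\<lambda>x. enn2real (fst z x m)" and b="\<lambda>y. enn2real (snd z y m)",
        OF assms(3), OF this]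
    show "(\<Sum>x\<in>Pow S. \<Sum>y\<in>Pow S. ip_sign x y * \<phi> x y z) \<le> 2 ^ card S * sqrt (2 ^ card S)"
      by (simp add: \<phi>_def)
  qed (use int in auto)
  finally show ?thesis .
qed

section \<open>The lower bound topology\<close>

datatype vx = Col nat bool bool nat | Tr nat nat | Pth nat | Lf nat

text \<open>
  \<open>Col i s t p\<close> is position \<open>p\<close> of one of the four columns of gadget \<open>i\<close>; \<open>Tr j q\<close> is the tree
  node above the positions \<open>q * 2 ^ j, \<dots>, (q + 1) * 2 ^ j - 1\<close> of the spine \<open>Tr 0\<close>. The path
  \<open>Pth\<close> makes the diameter equal to \<open>D\<close>, and the leaves \<open>Lf\<close> fill up the number of vertices.
\<close>

locale topology =
  fixes m l d D r :: nat
  assumes m_pos: "1 \<le> m" and l_pos: "1 \<le> l"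
    and tree_height: "d \<noteq> 0 \<Longrightarrow> l < 2 ^ d"
    and path_long: "(if d = 0 then l + 1 else 2 * d + 1) + 1 \<le> D div 2"
begin

definition vertex_set :: "vx set" where
  "vertex_set = {Col i s t p | i s t p. i \<le> m \<and> p \<le> l} \<union> {Tr j q | j q. j \<le> d \<and> q * 2 ^ j \<le> l}
     \<union> Pth ` {..D} \<union> Lf ` {..<r}"

text \<open>
  The Boolean argument tells whether the arc is heavy (weight 1) or light (weight 0). Two strands
  enter gadget \<open>i\<close> in the columns \<open>s = False\<close>. Alice (position 0) lets them leave
  directly if \<open>i \<notin> x\<close>, and in the columns \<open>s = True\<close> otherwise; Bob (position \<open>l\<close>) crosses the
  strands between these two pairs of columns iff \<open>i \<in> y\<close>. Hence gadget \<open>i\<close> swaps the strands iff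
  \<open>i \<in> x \<inter> y\<close>.
\<close>

inductive arc :: "nat set \<Rightarrow> nat set \<Rightarrow> bool \<Rightarrow> vx \<Rightarrow> vx \<Rightarrow> bool" for x y where
  column: "i \<le> m \<Longrightarrow> p < l \<Longrightarrow> arc x y False (Col i s t p) (Col i s t (Suc p))"
| rung: "i \<le> m \<Longrightarrow> p \<le> l \<Longrightarrow> w = (i \<noteq> 0 \<or> s \<or> t) \<Longrightarrow> arc x y w (Tr 0 p) (Col i s t p)"
| up: "j < d \<Longrightarrow> q * 2 ^ j \<le> l \<Longrightarrow> arc x y False (Tr j q) (Tr (Suc j) (q div 2))"
| spine: "p < l \<Longrightarrow> arc x y False (Tr 0 p) (Tr 0 (Suc p))"
| path: "i < D \<Longrightarrow> arc x y False (Pth i) (Pth (Suc i))"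
| hub: "arc x y False (Pth (D div 2)) (Tr 0 0)"
| leaf: "i < r \<Longrightarrow> arc x y False (Pth (D div 2)) (Lf i)"
| alice: "i < m \<Longrightarrow> w = (s \<noteq> (i \<in> x)) \<Longrightarrow> arc x y w (Col i s t 0) (Col (Suc i) False t 0)"
| close: "arc x y False (Col 0 False False 0) (Col m False True 0)"
| bob: "i \<le> m \<Longrightarrow> w = ((t' \<noteq> t) \<noteq> (i \<in> y)) \<Longrightarrow> arc x y w (Col i False t' l) (Col i True t l)"

definition lnk :: "vx \<Rightarrow> vx \<Rightarrow> bool" where
  "lnk u v \<longleftrightarrow> (\<exists>w. arc {} {} w u v \<or> arc {} {} w v u)"

definition light :: "nat set \<Rightarrow> nat set \<Rightarrow> vx \<Rightarrow> vx \<Rightarrow> bool" where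
  "light x y u v \<longleftrightarrow> arc x y False u v \<or> arc x y False v u"

lemma lnk_sym: "lnk u v \<Longrightarrow> lnk v u" and light_sym: "light x y u v \<Longrightarrow> light x y v u"
  by (auto simp: lnk_def light_def)

lemma arc_input: "arc x y w u v \<Longrightarrow> \<exists>w'. arc x' y' w' u v"
  by (erule arc.cases) (blast intro: arc.intros)+

lemma arc_lnk: "arc x y w u v \<Longrightarrow> lnk u v"
  using arc_input unfolding lnk_def by blast

lemma light_lnk: "light x y u v \<Longrightarrow> lnk u v"
  unfolding light_def using arc_lnk lnk_sym by blast

lemma arc_irrefl: "arc x y w u v \<Longrightarrow> u \<noteq> v"
  using m_pos by (auto elim!: arc.cases)

lemma lnk_irrefl: "\<not> lnk u u"
  unfolding lnk_def using arc_irrefl by blast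

lemma arc_vertex_set: "arc x y w u v \<Longrightarrow> u \<in> vertex_set \<and> v \<in> vertex_set"
proof (induction rule: arc.induct)
  case (up j q)
  have "(q div 2) * 2 ^ Suc j \<le> q * 2 ^ j" by simp
  then show ?case using up by (auto simp: vertex_set_def simp del: power_Suc)
qed (auto simp: vertex_set_def)

lemma lnk_vertex_set: "lnk u v \<Longrightarrow> u \<in> vertex_set \<and> v \<in> vertex_set"
  unfolding lnk_def using arc_vertex_set by blast

lemma finite_vertex_set: "finite vertex_set"
  and card_vertex_set: "card vertex_set = card (vertex_set - range Lf) + r"
  and card_vertex_set_le:
    "card (vertex_set - range Lf) \<le> 4 * (m + 1) * (l + 1) + (d + 1) * (l + 1) + (D + 1)"
proof -
  let ?C = "(\<lambda>(i, s, t, p). Col i s t p) ` ({..m} \<times> UNIV \<times> UNIV \<times> {..l})"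
  let ?C' = "{Col i s t p | i s t p. i \<le> m \<and> p \<le> l}"
  let ?T = "(\<lambda>(j, q). Tr j q) ` ({..d} \<times> {..l})"
  let ?T' = "{Tr j q | j q. j \<le> d \<and> q * 2 ^ j \<le> l}"
  have C: "?C' \<subseteq> ?C"
  proof
    fix v assume "v \<in> ?C'"
    then obtain i s t p where "v = Col i s t p" "i \<le> m" "p \<le> l" by blast
    then show "v \<in> ?C" by (intro image_eqI[of _ _ "(i, s, t, p)"]) simp_all
  qed
  then have finC: "finite ?C'" by (rule finite_subset) simp
  have T: "?T' \<subseteq> ?T"
  proof
    fix v assume "v \<in> ?T'"
    then obtain j q where v: "v = Tr j q" "j \<le> d" "q * 2 ^ j \<le> l" by blast
    have "q * 1 \<le> q * 2 ^ j" by (intro mult_le_mono2) simp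
    then have "q \<le> l" using v(3) by linarith
    then show "v \<in> ?T" using v by (intro image_eqI[of _ _ "(j, q)"]) simp_all
  qed
  then have finT: "finite ?T'" by (rule finite_subset) simp
  show fin: "finite vertex_set" unfolding vertex_set_def using finC finT by simp
  have "card ?C' \<le> card ?C" by (rule card_mono[OF _ C]) simp
  also have "\<dots> \<le> card ({..m} \<times> (UNIV :: bool set) \<times> (UNIV :: bool set) \<times> {..l})"
    by (rule card_image_le) simp
  also have "\<dots> = 4 * (m + 1) * (l + 1)" by (simp add: card_cartesian_product algebra_simps)
  finally have 1: "card ?C' \<le> 4 * (m + 1) * (l + 1)" .
  have "card ?T' \<le> card ?T" by (rule card_mono[OF _ T]) simp
  also have "\<dots> \<le> card ({..d} \<times> {..l})" by (rule card_image_le) simp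
  also have "\<dots> = (d + 1) * (l + 1)" by simp
  finally have 2: "card ?T' \<le> (d + 1) * (l + 1)" .
  have 3: "card (Pth ` {..D}) \<le> D + 1" using card_image_le[of "{..D}" Pth] by simp
  have 4: "card (Lf ` {..<r}) = r" by (subst card_image) (auto simp: inj_on_def)
  have "card (?C' \<union> ?T' \<union> Pth ` {..D}) \<le> 4 * (m + 1) * (l + 1) + (d + 1) * (l + 1) + (D + 1)"
    using 1 2 3 by (intro order_trans[OF card_Un_le] add_mono)
  moreover have "vertex_set - range Lf = ?C' \<union> ?T' \<union> Pth ` {..D}" "vertex_set \<inter> range Lf = Lf ` {..<r}"
    unfolding vertex_set_def by blast+
  ultimately show "card vertex_set = card (vertex_set - range Lf) + r"
    "card (vertex_set - range Lf) \<le> 4 * (m + 1) * (l + 1) + (d + 1) * (l + 1) + (D + 1)"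
    using card_Int_Diff[OF fin, of "range Lf"] 4 by simp_all
qed

subsection \<open>Distances\<close>

definition near :: "nat \<Rightarrow> vx \<Rightarrow> vx \<Rightarrow> bool" where
  "near n u v \<longleftrightarrow> (\<exists>i\<le>n. (u, v) \<in> {(u, v). lnk u v} ^^ i)"

lemma near_refl: "near n u u"
  unfolding near_def by (rule exI[of _ 0]) simp

lemma near_mono: "near n u v \<Longrightarrow> n \<le> n' \<Longrightarrow> near n' u v"
  unfolding near_def using le_trans by blast

lemma near_trans: "near n u v \<Longrightarrow> near n' v w \<Longrightarrow> near (n + n') u w"
  unfolding near_def by (metis add_mono relpow_trans)

lemma near_sym: "near n u v \<Longrightarrow> near n v u"
proof -
  have "(v, u) \<in> {(u, v). lnk u v} ^^ i" if "(u, v) \<in> {(u, v). lnk u v} ^^ i" for i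
    using that
  proof (induction i arbitrary: v)
    case (Suc i)
    then obtain w where "(u, w) \<in> {(u, v). lnk u v} ^^ i" "lnk w v" by auto
    then have "(v, w) \<in> {(u, v). lnk u v}" "(w, u) \<in> {(u, v). lnk u v} ^^ i"
      using Suc.IH lnk_sym by auto
    then show ?case by (rule relpow_Suc_I2)
  qed simp
  then show "near n u v \<Longrightarrow> near n v u" unfolding near_def by blast
qed

lemma near_lnk: "lnk u v \<Longrightarrow> near 1 u v"
  unfolding near_def by (rule exI[of _ 1]) auto

lemma near_arc: "arc {} {} w u v \<Longrightarrow> near 1 u v"
  by (intro near_lnk arc_lnk)

lemma near_chain:
  assumes "\<And>i. a \<le> i \<Longrightarrow> i < b \<Longrightarrow> near 1 (f i) (f (Suc i))" "a \<le> b"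
  shows "near (b - a) (f a) (f b)"
  using assms(2,1)
proof (induction b rule: dec_induct)
  case base
  show ?case by (simp add: near_refl)
next
  case (step b)
  then have "near (b - a + 1) (f a) (f (Suc b))"
    by (intro near_trans[of _ _ "f b"]) auto
  then show ?case using step.hyps by (simp add: Suc_diff_le)
qed

lemma near_spine: "v \<in> vertex_set \<Longrightarrow> v = Tr j q \<Longrightarrow> near (if d = 0 then l else 2 * d) v (Tr 0 0)"
proof (cases "d = 0")
  case True
  assume "v \<in> vertex_set" "v = Tr j q"
  then have v: "v = Tr 0 q" "q \<le> l" using True unfolding vertex_set_def by auto
  have "near (q - 0) (Tr 0 0) (Tr 0 q)"
    using v(2) by (intro near_chain near_arc[OF spine]) auto
  then have "near q v (Tr 0 0)" using v(1) by (simp add: near_sym)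
  then have "near l v (Tr 0 0)" using v(2) by (rule near_mono)
  then show ?thesis using True by simp
next
  case False
  assume v: "v \<in> vertex_set" "v = Tr j q"
  have root: "near (d - j) (Tr j q) (Tr d 0)" if "j \<le> d" "q * 2 ^ j \<le> l" for j q
    using that
  proof (induction j arbitrary: q rule: inc_induct)
    case base
    then have "q = 0" using tree_height[OF False] by (cases q) auto
    then show ?case by (simp add: near_refl)
  next
    case (step j)
    have "(q div 2) * 2 ^ Suc j \<le> q * 2 ^ j" by simp
    then have "(q div 2) * 2 ^ Suc j \<le> l" using step.prems by linarith
    then have "near (1 + (d - Suc j)) (Tr j q) (Tr d 0)"
      using step by (intro near_trans[OF near_arc[OF up] step.IH])
    then show ?case using step.hyps by (simp add: Suc_diff_Suc)
  qed
  have "near ((d - j) + (d - 0)) (Tr j q) (Tr 0 0)"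
    using v by (intro near_trans[OF root near_sym[OF root]]) (auto simp: vertex_set_def)
  then show ?thesis using False v(2) near_mono[of "(d - j) + (d - 0)" _ _ "2 * d"] by auto
qed

lemma near_hub:
  assumes "v \<in> vertex_set" "v \<notin> range Pth"
  shows "near (D div 2) v (Pth (D div 2))"
proof -
  define h where "h = (if d = 0 then l else 2 * d)"
  have h: "h + 2 \<le> D div 2" using path_long by (simp add: h_def split: if_splits)
  have "near (h + 2) v (Pth (D div 2))"
  proof (cases v)
    case (Col i s t p)
    then have "i \<le> m" "p \<le> l" using assms(1) by (auto simp: vertex_set_def)
    moreover from this have "Tr 0 p \<in> vertex_set" by (auto simp: vertex_set_def)
    ultimately have "near (1 + (h + 1)) v (Pth (D div 2))"
      unfolding Col h_def
      by (intro near_trans[OF near_sym[OF near_arc[OF rung]] near_trans[OF near_spine near_sym[OF near_arc[OF hub]]]]) auto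
    then show ?thesis by simp
  next
    case (Tr j q)
    then have "near (h + 1) v (Pth (D div 2))"
      using assms(1) near_spine near_trans near_sym[OF near_arc[OF hub]] unfolding h_def by blast
    then show ?thesis by (rule near_mono) simp
  next
    case (Lf i)
    then have "near 1 v (Pth (D div 2))"
      using assms(1) by (intro near_sym[OF near_arc]) (auto simp: vertex_set_def intro: leaf)
    then show ?thesis by (rule near_mono) simp
  qed (use assms(2) in auto)
  then show ?thesis using h near_mono by blast
qed

lemma near_path: "i \<le> j \<Longrightarrow> j \<le> D \<Longrightarrow> near (j - i) (Pth i) (Pth j)"
  by (intro near_chain near_arc[OF path]) auto

lemma near_diameter:
  assumes "u \<in> vertex_set" "v \<in> vertex_set"
  shows "near D u v"
proof -
  have path: "near (D - D div 2) (Pth i) (Pth (D div 2))" if "i \<le> D" for i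
  proof (cases "i \<le> D div 2")
    case True
    then show ?thesis by (intro near_mono[OF near_path]) linarith+
  next
    case False
    then show ?thesis using that by (intro near_sym[OF near_mono[OF near_path]]) linarith+
  qed
  have far: "near (D - D div 2) v (Pth (D div 2))" if "v \<in> vertex_set" for v
  proof (cases "v \<in> range Pth")
    case True
    then show ?thesis using path that by (auto simp: vertex_set_def)
  next
    case False
    show ?thesis by (rule near_mono[OF near_hub[OF that False]]) linarith
  qed
  consider i j where "u = Pth i" "v = Pth j" | "u \<notin> range Pth" | "v \<notin> range Pth" by blast
  then show ?thesis
  proof cases
    case (1 i j)
    then have ij: "i \<le> D" "j \<le> D" using assms by (auto simp: vertex_set_def)
    show ?thesis
    proof (cases "i \<le> j")
      case True
      then show ?thesis unfolding 1 using ij by (intro near_mono[OF near_path]) linarith+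
    next
      case False
      then show ?thesis unfolding 1 using ij by (intro near_sym[OF near_mono[OF near_path]]) linarith+
    qed
  next
    case 2
    from near_trans[OF near_hub[OF assms(1) 2] near_sym[OF far[OF assms(2)]]] show ?thesis by simp
  next
    case 3
    from near_trans[OF far[OF assms(1)] near_sym[OF near_hub[OF assms(2) 3]]] show ?thesis by simp
  qed
qed

fun potential :: "vx \<Rightarrow> nat" where
  "potential (Pth i) = i" | "potential _ = D div 2"

lemma potential_lnk: "lnk u v \<Longrightarrow> potential v \<le> potential u + 1"
  unfolding lnk_def by (auto elim!: arc.cases)

subsection \<open>Connectivity of the light subgraph\<close>

definition lconn :: "nat set \<Rightarrow> nat set \<Rightarrow> vx \<Rightarrow> vx \<Rightarrow> bool" where
  "lconn x y u v \<longleftrightarrow> (u, v) \<in> {(u, v). light x y u v}\<^sup>*"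

lemma lconn_refl [simp]: "lconn x y u u"
  and lconn_trans [trans]: "lconn x y u v \<Longrightarrow> lconn x y v w \<Longrightarrow> lconn x y u w"
  and lconn_arc: "arc x y False u v \<Longrightarrow> lconn x y u v"
  by (auto simp: lconn_def light_def)

lemma lconn_sym: "lconn x y u v \<Longrightarrow> lconn x y v u"
  unfolding lconn_def by (rule symD[OF sym_rtrancl]) (auto simp: sym_def intro: light_sym)

lemma lconn_chain:
  assumes "\<And>i. a \<le> i \<Longrightarrow> i < b \<Longrightarrow> lconn x y (f i) (f (Suc i))" "a \<le> b"
  shows "lconn x y (f a) (f b)"
  using assms(2,1)
proof (induction b rule: dec_induct)
  case (step b)
  then have "lconn x y (f a) (f b)" "lconn x y (f b) (f (Suc b))" by simp_all
  then show ?case by (rule lconn_trans)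
qed simp

definition strand_parity :: "nat set \<Rightarrow> nat set \<Rightarrow> nat \<Rightarrow> bool" where
  "strand_parity x y i = odd (card (x \<inter> y \<inter> {..<i}))"

lemma strand_parity_0 [simp]: "\<not> strand_parity x y 0"
  by (simp add: strand_parity_def)

lemma strand_parity_Suc:
  "strand_parity x y (Suc i) = (strand_parity x y i \<noteq> (i \<in> x \<inter> y))"
proof -
  have "x \<inter> y \<inter> {..<Suc i} = (if i \<in> x \<inter> y then insert i (x \<inter> y \<inter> {..<i}) else x \<inter> y \<inter> {..<i})"
    by (auto simp: less_Suc_eq)
  then show ?thesis by (simp add: strand_parity_def)
qed

lemma strand_parity_m: "x \<subseteq> {..<m} \<Longrightarrow> strand_parity x y m = odd (card (x \<inter> y))"
  unfolding strand_parity_def by (rule arg_cong[where f="\<lambda>S. odd (card S)"]) auto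

lemma lconn_even:
  assumes "x \<subseteq> {..<m}" "even (card (x \<inter> y))" "u \<in> vertex_set"
  shows "lconn x y u (Tr 0 0)"
proof -
  have col: "lconn x y (Col i s t p) (Col i s t 0)" if "i \<le> m" "p \<le> l" for i s t p
    by (rule lconn_sym[OF lconn_chain[where f="Col i s t"]])
      (use that in \<open>auto intro!: lconn_arc[OF column]\<close>)
  have bob': "lconn x y (Col i True t 0) (Col i False (t \<noteq> (i \<in> y)) 0)" if "i \<le> m" for i t
  proof -
    have "lconn x y (Col i True t 0) (Col i True t l)" using col that lconn_sym by blast
    also have "lconn x y \<dots> (Col i False (t \<noteq> (i \<in> y)) l)"
      by (rule lconn_sym[OF lconn_arc[OF bob]]) (use that in auto)
    also have "lconn x y \<dots> (Col i False (t \<noteq> (i \<in> y)) 0)" using col that by blast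
    finally show ?thesis .
  qed
  have strand: "lconn x y (Col i False t 0) (Col 0 False (t \<noteq> strand_parity x y i) 0)" if "i \<le> m" for i t
    using that
  proof (induction i arbitrary: t)
    case (Suc i)
    have "lconn x y (Col (Suc i) False t 0) (Col i (i \<in> x) t 0)"
      by (rule lconn_sym[OF lconn_arc[OF alice]]) (use Suc.prems in auto)
    also have "lconn x y \<dots> (Col i False (t \<noteq> (i \<in> x \<inter> y)) 0)"
      using bob'[of i t] Suc.prems by (cases "i \<in> x") auto
    also have "lconn x y \<dots> (Col 0 False ((t \<noteq> (i \<in> x \<inter> y)) \<noteq> strand_parity x y i) 0)"
      using Suc by simp
    also have "((t \<noteq> (i \<in> x \<inter> y)) \<noteq> strand_parity x y i) = (t \<noteq> strand_parity x y (Suc i))"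
      by (auto simp: strand_parity_Suc)
    finally show ?case .
  qed simp
  have tr0: "lconn x y (Tr 0 p) (Tr 0 0)" if "p \<le> l" for p
    by (rule lconn_sym[OF lconn_chain[where f="Tr 0"]])
      (use that in \<open>auto intro!: lconn_arc[OF spine]\<close>)
  have zero: "lconn x y (Col 0 False t 0) (Tr 0 0)" for t
  proof -
    have 0: "lconn x y (Col 0 False False 0) (Tr 0 0)"
      by (rule lconn_sym[OF lconn_arc[OF rung]]) auto
    have "lconn x y (Col m False True 0) (Col 0 False True 0)"
      using strand[of m True] strand_parity_m[OF assms(1)] assms(2) by simp
    then have "lconn x y (Col 0 False True 0) (Col 0 False False 0)"
      using lconn_sym lconn_trans lconn_arc[OF close] by blast
    then show ?thesis using 0 lconn_trans by (cases t) auto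
  qed
  have first: "lconn x y (Col i False t 0) (Tr 0 0)" if "i \<le> m" for i t
    using lconn_trans[OF strand[OF that] zero] .
  have pth: "lconn x y (Pth i) (Tr 0 0)" if "i \<le> D" for i
  proof -
    have "lconn x y (Pth 0) (Pth j)" if "j \<le> D" for j
      by (rule lconn_chain[where f=Pth]) (use that in \<open>auto intro!: lconn_arc[OF path]\<close>)
    then have "lconn x y (Pth i) (Pth 0)" "lconn x y (Pth 0) (Pth (D div 2))"
      using that by (auto intro: lconn_sym)
    then have "lconn x y (Pth i) (Pth (D div 2))" by (rule lconn_trans)
    then show ?thesis using lconn_arc[OF hub] lconn_trans by blast
  qed
  show ?thesis
  proof (cases u)
    case (Col i s t p)
    then have ip: "i \<le> m" "p \<le> l" using assms(3) by (auto simp: vertex_set_def)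
    have "lconn x y (Col i s t 0) (Tr 0 0)"
      using first[OF ip(1)] lconn_trans[OF bob'[OF ip(1)] first[OF ip(1)]] by (cases s) auto
    then show ?thesis using col[OF ip] lconn_trans Col by blast
  next
    case (Tr j q)
    have "lconn x y (Tr j q) (Tr 0 (q * 2 ^ j))" if "j \<le> d" "q * 2 ^ j \<le> l" for j q
      using that
    proof (induction j arbitrary: q)
      case (Suc j)
      have "lconn x y (Tr (Suc j) q) (Tr j (2 * q))"
        using Suc.prems up[of j "2 * q"] by (simp add: mult_ac lconn_sym[OF lconn_arc])
      also have "lconn x y \<dots> (Tr 0 (2 * q * 2 ^ j))"
        using Suc.prems by (intro Suc.IH) (auto simp: mult_ac)
      finally show ?case by (simp add: mult_ac)
    qed simp
    then show ?thesis using assms(3) Tr tr0 lconn_trans by (fastforce simp: vertex_set_def)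
  next
    case (Pth i)
    then show ?thesis using pth assms(3) by (auto simp: vertex_set_def)
  next
    case (Lf i)
    then have "lconn x y u (Pth (D div 2))"
      using assms(3) by (auto simp: vertex_set_def intro!: lconn_sym[OF lconn_arc[OF leaf]])
    then show ?thesis using pth[of "D div 2"] lconn_trans by auto
  qed
qed

text \<open>If the total permutation is a swap, the two strands form two components.\<close>

fun strand :: "nat set \<Rightarrow> nat set \<Rightarrow> vx \<Rightarrow> bool" where
  "strand x y (Col i s t p) = ((t \<noteq> strand_parity x y i) \<noteq> (s \<and> i \<in> y))"
| "strand x y _ = False"

lemma strand_light:
  assumes "x \<subseteq> {..<m}" "odd (card (x \<inter> y))" "light x y u v"
  shows "strand x y u = strand x y v"
proof -
  have "strand x y u = strand x y v" if "arc x y w u v" "\<not> w" for u v w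
    using that strand_parity_m[OF assms(1), of y] assms(2)
    by (cases rule: arc.cases) (auto simp: strand_parity_Suc)
  then show ?thesis using assms(3) unfolding light_def by blast
qed

lemma not_lconn_odd:
  assumes "x \<subseteq> {..<m}" "odd (card (x \<inter> y))"
  shows "\<not> lconn x y (Col 0 False True 0) (Tr 0 0)"
proof
  assume "lconn x y (Col 0 False True 0) (Tr 0 0)"
  then have "strand x y (Col 0 False True 0) = strand x y (Tr 0 0)"
    unfolding lconn_def
    by (induction rule: rtrancl_induct) (use strand_light[OF assms] in auto)
  then show False by simp
qed

subsection \<open>The regions of Alice and Bob\<close>

text \<open>
  After \<open>\<tau>\<close> rounds Alice still knows the positions below \<open>l - \<tau>\<close> and all tree nodes above them;
  Bob knows the positions above \<open>\<tau>\<close> and all tree nodes above them.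
\<close>

fun inA :: "nat \<Rightarrow> vx \<Rightarrow> bool" where
  "inA \<tau> (Col i s t p) \<longleftrightarrow> p + \<tau> < l"
| "inA \<tau> (Tr j q) \<longleftrightarrow> q * 2 ^ j + \<tau> < l"
| "inA \<tau> _ \<longleftrightarrow> True"

fun inB :: "nat \<Rightarrow> vx \<Rightarrow> bool" where
  "inB \<tau> (Col i s t p) \<longleftrightarrow> \<tau> < p"
| "inB \<tau> (Tr j q) \<longleftrightarrow> \<tau> + 1 < (q + 1) * 2 ^ j"
| "inB \<tau> _ \<longleftrightarrow> False"

lemma inA_Suc: "inA (Suc \<tau>) v \<Longrightarrow> inA \<tau> v" and inB_Suc: "inB (Suc \<tau>) v \<Longrightarrow> inB \<tau> v"
  by (cases v; simp)+

lemma inA_or_inB: "2 * \<tau> < l \<Longrightarrow> inA \<tau> v \<or> inB \<tau> v"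
proof (cases v)
  case (Tr j q)
  assume "2 * \<tau> < l"
  moreover have "(q + 1) * 2 ^ j \<ge> q * 2 ^ j + 1" by simp
  ultimately show ?thesis unfolding Tr inA.simps inB.simps by linarith
qed auto

lemma half_cross: "(q :: nat) div 2 * 2 ^ Suc j \<le> q * 2 ^ j"
  "(q + 1) * 2 ^ j \<le> (q div 2 + 1) * 2 ^ Suc j"
proof -
  show "(q :: nat) div 2 * 2 ^ Suc j \<le> q * 2 ^ j" by simp
  have "(q + 1) * 2 ^ j \<le> (2 * (q div 2 + 1)) * 2 ^ j" by (intro mult_right_mono) auto
  then show "(q + 1) * 2 ^ j \<le> (q div 2 + 1) * 2 ^ Suc j" by (simp only: power_Suc mult_ac)
qed

text \<open>
  Only tree edges carry information into a region, one on each level: the column edges are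
  outrun by the shrinking of the region.
\<close>

lemma inA_crossing:
  assumes "lnk u v" "inA (Suc \<tau>) u" "\<not> inA \<tau> v" "\<tau> < l"
  shows "\<exists>j<d. u = Tr (Suc j) ((l - \<tau> - 1) div 2 ^ Suc j) \<and> v = Tr j (2 * ((l - \<tau> - 1) div 2 ^ Suc j) + 1)"
proof -
  have down: ?thesis if u: "u = Tr (Suc j) (q div 2)" and v: "v = Tr j q" and j: "j < d" for j q
  proof -
    define q' where "q' = q div 2"
    have a: "q' * 2 ^ Suc j + Suc \<tau> < l" and b: "q * 2 ^ j + \<tau> \<ge> l"
      using assms u v by (auto simp: q'_def)
    have q: "q = 2 * q' + 1"
    proof (rule ccontr)
      assume "q \<noteq> 2 * q' + 1"
      then have "q = 2 * q'" by (simp add: q'_def)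
      then show False using a b by simp
    qed
    have "2 * (q' * 2 ^ j) + 1 \<le> l - \<tau> - 1 + 1" "l - \<tau> \<le> 2 * (q' * 2 ^ j) + 2 ^ j"
      using a b by (auto simp: q algebra_simps)
    then have "(l - \<tau> - 1) div 2 ^ Suc j = q'"
      by (intro div_nat_eqI) (use a in \<open>auto simp: algebra_simps\<close>)
    then have "u = Tr (Suc j) ((l - \<tau> - 1) div 2 ^ Suc j)" "v = Tr j (2 * ((l - \<tau> - 1) div 2 ^ Suc j) + 1)"
      using u[folded q'_def] v[unfolded q] by (simp_all only:)
    then show ?thesis using j by blast
  qed
  have "False" if "arc {} {} w u v" for w
    using that
  proof (cases rule: arc.cases)
    case (up j q)
    then show ?thesis using assms(2,3) half_cross(1)[of q j] unfolding up inA.simps by linarith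
  qed (use assms(2,3,4) in auto)
  moreover have ?thesis if "arc {} {} w v u" for w
    using that
  proof (cases rule: arc.cases)
    case (up j q)
    then show ?thesis by (intro down)
  qed (use assms(2,3,4) in auto)
  ultimately show ?thesis using assms(1) unfolding lnk_def by blast
qed

lemma inB_crossing:
  assumes "lnk u v" "inB (Suc \<tau>) u" "\<not> inB \<tau> v" "\<tau> < l"
  shows "\<exists>j<d. u = Tr (Suc j) ((\<tau> + 1) div 2 ^ Suc j) \<and> v = Tr j (2 * ((\<tau> + 1) div 2 ^ Suc j))"
proof -
  have down: ?thesis if u: "u = Tr (Suc j) (q div 2)" and v: "v = Tr j q" and j: "j < d" for j q
  proof -
    define q' where "q' = q div 2"
    have a: "\<tau> + 2 < (q' + 1) * 2 ^ Suc j" and b: "(q + 1) * 2 ^ j \<le> \<tau> + 1"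
      using assms u v by (auto simp: q'_def)
    have q: "q = 2 * q'"
    proof (rule ccontr)
      assume "q \<noteq> 2 * q'"
      then have "q = 2 * q' + 1" unfolding q'_def by presburger
      then show False using a b by simp
    qed
    have "(\<tau> + 1) div 2 ^ Suc j = q'"
      by (intro div_nat_eqI) (use a b in \<open>auto simp: q algebra_simps\<close>)
    then have "u = Tr (Suc j) ((\<tau> + 1) div 2 ^ Suc j)" "v = Tr j (2 * ((\<tau> + 1) div 2 ^ Suc j))"
      using u[folded q'_def] v[unfolded q] by (simp_all only:)
    then show ?thesis using j by blast
  qed
  have "False" if "arc {} {} w u v" for w
    using that
  proof (cases rule: arc.cases)
    case (up j q)
    then show ?thesis using assms(2,3) half_cross(2)[of q j] unfolding up inB.simps by linarith
  qed (use assms(2,3,4) in auto)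
  moreover have ?thesis if "arc {} {} w v u" for w
    using that
  proof (cases rule: arc.cases)
    case (up j q)
    then show ?thesis by (intro down)
  qed (use assms(2,3,4) in auto)
  ultimately show ?thesis using assms(1) unfolding lnk_def by blast
qed

lemma arc_inA: "arc x y w u v \<Longrightarrow> inA 0 u \<or> inA 0 v \<Longrightarrow> arc x y' w u v"
  by (erule arc.cases) (auto intro: arc.intros)

lemma arc_inB: "arc x y w u v \<Longrightarrow> inB 0 u \<or> inB 0 v \<Longrightarrow> arc x' y w u v"
  by (erule arc.cases) (auto intro: arc.intros)

end

section \<open>CONGEST executions\<close>

lemma incident_cong: "edges G = edges G' \<Longrightarrow> incident G = incident G'"
  by (simp add: incident_def fun_eq_iff)

lemma vertex_step_cong: "edges G = edges G' \<Longrightarrow> vertex_step A G = vertex_step A G'"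
  unfolding vertex_step_def inbox_def by (simp only: incident_cong[of G G'])

lemma mgraph_wf_edge:
  assumes "mgraph_wf G" "e \<in> incident G v"
  obtains w where "fst e = {v, w}" "v \<noteq> w" "v \<in> verts G" "w \<in> verts G" "e \<in> incident G w"
    "the_elem (fst e - {v}) = w"
proof -
  obtain S j where e: "e = (S, j)" by (cases e)
  then have "e \<in> edges G" "v \<in> S" "S \<subseteq> verts G" "card S = 2"
    using assms unfolding mgraph_wf_def incident_def by auto
  then obtain w where "S = {v, w}" "v \<noteq> w" by (auto simp: card_2_iff)
  then show ?thesis
    using that[of w] e \<open>e \<in> edges G\<close> \<open>S \<subseteq> verts G\<close> assms
    by (auto simp: incident_def insert_Diff_if)
qed

subsection \<open>Termination\<close>

lemma run_undefined: "mgraph_wf G \<Longrightarrow> \<sigma> \<in> set_pmf (run A G t) \<Longrightarrow> v \<notin> verts G \<Longrightarrow> \<sigma> v = undefined"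
  by (cases t) (auto simp: set_Pi_pmf mgraph_wf_def PiE_dflt_def)

lemma step_terminated:
  assumes "mgraph_wf G" "\<sigma> \<in> set_pmf (run A G t)" "terminated A G \<sigma>"
  shows "Pi_pmf (verts G) undefined (vertex_step A G \<sigma>) = return_pmf \<sigma>"
proof -
  have "Pi_pmf (verts G) undefined (vertex_step A G \<sigma>)
      = Pi_pmf (verts G) undefined (\<lambda>v. return_pmf (\<sigma> v))"
    using assms(3) by (intro Pi_pmf_cong) (auto simp: vertex_step_def terminated_def)
  also have "\<dots> = return_pmf \<sigma>"
    using assms(1) run_undefined[OF assms(1,2)]
    by (subst Pi_pmf_return_pmf) (auto simp: mgraph_wf_def fun_eq_iff)
  finally show ?thesis .
qed

lemma prob_run_mono:
  assumes "mgraph_wf G" "\<And>\<sigma>. \<sigma> \<in> S \<Longrightarrow> terminated A G \<sigma>" "t \<le> t'"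
  shows "measure_pmf.prob (run A G t) S \<le> measure_pmf.prob (run A G t') S"
  using assms(3)
proof (induction rule: dec_induct)
  case (step t')
  have "emeasure (run A G t') S = (\<integral>\<^sup>+\<sigma>. indicator S \<sigma> \<partial>run A G t')" by simp
  also have "\<dots> \<le> (\<integral>\<^sup>+\<sigma>. emeasure (Pi_pmf (verts G) undefined (vertex_step A G \<sigma>)) S \<partial>run A G t')"
    by (intro nn_integral_mono_AE AE_pmfI)
      (auto simp: indicator_def step_terminated[OF assms(1) _ assms(2)])
  also have "\<dots> = emeasure (run A G (Suc t')) S"
    by (simp add: emeasure_bind_pmf)
  finally show ?case
    using step.IH by (simp add: measure_pmf.emeasure_eq_measure)
qed simp

lemma rounds_le_terminated:
  assumes "mgraph_wf G" "rounds c A G \<le> enat T"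
  shows "high_prob c G \<le> measure_pmf.prob (run A G T) {\<sigma>. terminated A G \<sigma>}"
proof -
  let ?S = "{enat t | t. high_prob c G \<le> measure_pmf.prob (run A G t) {\<sigma>. terminated A G \<sigma>}}"
  have "?S \<noteq> {}"
    using assms(2) unfolding rounds_def by (auto simp: Inf_enat_def split: if_splits)
  then have "Inf ?S \<in> ?S" by (meson ex_in_conv wellorder_InfI)
  then obtain t where t: "high_prob c G \<le> measure_pmf.prob (run A G t) {\<sigma>. terminated A G \<sigma>}"
    "rounds c A G = enat t"
    unfolding rounds_def by auto
  then show ?thesis
    using prob_run_mono[OF assms(1), of "{\<sigma>. terminated A G \<sigma>}" A t T] assms(2) by auto
qed

lemma prob_success_at_termination:
  assumes wf: "mgraph_wf G" and S: "\<And>\<sigma>. \<sigma> \<in> S \<Longrightarrow> terminated A G \<sigma>"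
    and T: "rounds c A G \<le> enat T"
    and succ: "high_prob c G \<le> (SUP t. measure_pmf.prob (run A G t) S)"
  shows "2 * high_prob c G - 1 \<le> measure_pmf.prob (run A G T) S"
proof -
  let ?P = "\<lambda>t. measure_pmf.prob (run A G t)"
  let ?Z = "{\<sigma>. terminated A G \<sigma>}"
  have split: "?P t (?Z - S) = ?P t ?Z - ?P t S" for t
    using S by (intro measure_pmf.finite_measure_Diff) auto
  have "?P t S \<le> ?P T S + 1 - ?P T ?Z" for t
  proof (cases "t \<le> T")
    case True
    then show ?thesis
      using prob_run_mono[where S=S, OF wf S True] measure_pmf.prob_le_1[of "run A G T" ?Z] by linarith
  next
    case False
    have "?P T (?Z - S) \<le> ?P t (?Z - S)"
      using False by (intro prob_run_mono[OF wf]) auto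
    then show ?thesis
      using split[of t] split[of T] measure_pmf.prob_le_1[of "run A G t" ?Z] by linarith
  qed
  then have "(SUP t. ?P t S) \<le> ?P T S + 1 - ?P T ?Z"
    by (intro cSUP_least) auto
  then show ?thesis using succ rounds_le_terminated[OF wf T] by linarith
qed

subsection \<open>Truncated messages\<close>

definition truncate_msgs :: "nat \<Rightarrow> 's congest_alg \<Rightarrow> 's congest_alg" where
  "truncate_msgs B A = A\<lparr>send := \<lambda>s e. take B (send A s e)\<rparr>"

lemma msg_truncate_msgs: "msg (truncate_msgs B A) s e = take B (msg A s e)"
  by (simp add: msg_def truncate_msgs_def)

lemma output_truncate_msgs [simp]: "output (truncate_msgs B A) = output A"
  and next_truncate_msgs [simp]: "next (truncate_msgs B A) = next A"
  by (simp_all add: truncate_msgs_def)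

lemma run_truncate_msgs:
  assumes wf: "mgraph_wf G"
    and B: "\<And>t \<sigma> v e. \<sigma> \<in> set_pmf (run A G t) \<Longrightarrow> v \<in> verts G \<Longrightarrow> e \<in> incident G v \<Longrightarrow>
      length (msg A (\<sigma> v) e) \<le> B"
  shows "run (truncate_msgs B A) G t = run A G t"
proof (induction t)
  case 0
  show ?case by (simp add: truncate_msgs_def)
next
  case (Suc t)
  have inbox: "inbox (truncate_msgs B A) G \<sigma> v = inbox A G \<sigma> v" if \<sigma>: "\<sigma> \<in> set_pmf (run A G t)" for \<sigma> v
  proof
    fix e
    show "inbox (truncate_msgs B A) G \<sigma> v e = inbox A G \<sigma> v e"
    proof (cases "e \<in> incident G v")
      case True
      then obtain w where "w \<in> verts G" "e \<in> incident G w" "the_elem (fst e - {v}) = w"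
        using mgraph_wf_edge[OF wf] by metis
      then show ?thesis using B[OF \<sigma>, of w e] by (simp add: inbox_def msg_truncate_msgs)
    qed (simp add: inbox_def)
  qed
  have "vertex_step (truncate_msgs B A) G \<sigma> = vertex_step A G \<sigma>" if "\<sigma> \<in> set_pmf (run A G t)" for \<sigma>
    by (intro ext) (simp add: vertex_step_def inbox[OF that])
  then show ?case unfolding run.simps Suc.IH by (intro bind_pmf_cong) simp_all
qed

subsection \<open>Simulating a round in a region\<close>

text \<open>
  The states on \<open>P\<close> after a round are simulated from the states on \<open>R\<close> before it, given the
  messages over the edges that lead from outside \<open>R\<close> into \<open>P\<close>.
\<close>

definition cut_edges :: "mgraph \<Rightarrow> nat set \<Rightarrow> nat set \<Rightarrow> edge set" where
  "cut_edges G P R = {e \<in> edges G. \<exists>u v. fst e = {u, v} \<and> u \<in> P \<and> v \<notin> R}"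

definition cut_msgs :: "'s congest_alg \<Rightarrow> mgraph \<Rightarrow> nat set \<Rightarrow> nat set \<Rightarrow> (nat \<Rightarrow> 's) \<Rightarrow> edge \<Rightarrow> bool list" where
  "cut_msgs A G P R \<sigma> e = (if e \<in> cut_edges G P R then msg A (\<sigma> (the_elem (fst e - R))) e else [])"

definition sim_step ::
    "'s congest_alg \<Rightarrow> mgraph \<Rightarrow> nat set \<Rightarrow> nat set \<Rightarrow> (nat \<Rightarrow> 's) \<Rightarrow> (edge \<Rightarrow> bool list) \<Rightarrow> nat \<Rightarrow> 's pmf" where
  "sim_step A G P R \<sigma> r v =
     (if output A (\<sigma> v) = None
      then next A (\<sigma> v) (\<lambda>e. if e \<in> cut_edges G P R \<inter> incident G v then r e else inbox A G \<sigma> v e)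
      else return_pmf (\<sigma> v))"

lemma vertex_step_sim_step:
  assumes wf: "mgraph_wf G" and "P \<subseteq> R" "v \<in> P"
  shows "vertex_step A G \<sigma> v = sim_step A G P R \<sigma> (cut_msgs A G P R \<sigma>) v"
proof -
  have "inbox A G \<sigma> v e = cut_msgs A G P R \<sigma> e" if e: "e \<in> cut_edges G P R" "e \<in> incident G v" for e
  proof -
    obtain w where w: "fst e = {v, w}" "v \<noteq> w" "the_elem (fst e - {v}) = w"
      using mgraph_wf_edge[OF wf e(2)] by metis
    have "w \<notin> R" using e(1) w assms(2,3) by (auto simp: cut_edges_def doubleton_eq_iff)
    moreover have "v \<in> R" using assms by auto
    ultimately have "fst e - R = {w}" using w by auto
    then show ?thesis using e w by (simp add: inbox_def cut_msgs_def)
  qed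
  then have "(\<lambda>e. if e \<in> cut_edges G P R \<inter> incident G v then cut_msgs A G P R \<sigma> e else inbox A G \<sigma> v e)
      = inbox A G \<sigma> v"
    by auto
  then show ?thesis by (simp add: vertex_step_def sim_step_def)
qed

lemma sim_step_agree:
  assumes wf: "mgraph_wf G" and "P \<subseteq> R" "v \<in> P" "agree R \<sigma> \<sigma>'"
  shows "sim_step A G P R \<sigma> r v = sim_step A G P R \<sigma>' r v"
proof -
  have "\<sigma> v = \<sigma>' v" using assms by (auto simp: agree_def)
  moreover have "inbox A G \<sigma> v e = inbox A G \<sigma>' v e" if e: "e \<notin> cut_edges G P R \<inter> incident G v" for e
  proof (cases "e \<in> incident G v")
    case True
    then obtain w where w: "fst e = {v, w}" "the_elem (fst e - {v}) = w"
      using mgraph_wf_edge[OF wf] by metis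
    have "w \<in> R"
      using e True w(1) assms(3) by (auto simp: cut_edges_def incident_def)
    then have "\<sigma> w = \<sigma>' w" using assms(4) by (simp add: agree_def)
    then show ?thesis using w by (simp add: inbox_def)
  qed (simp add: inbox_def)
  ultimately show ?thesis unfolding sim_step_def by (auto intro!: arg_cong[where f="next A (\<sigma>' v)"])
qed

lemma cut_msgs_agree:
  assumes wf: "mgraph_wf G" and "P \<subseteq> R" "verts G - R \<subseteq> S" "agree S \<sigma> \<sigma>'"
  shows "cut_msgs A G P R \<sigma> = cut_msgs A G P R \<sigma>'"
proof
  fix e
  show "cut_msgs A G P R \<sigma> e = cut_msgs A G P R \<sigma>' e"
  proof (cases "e \<in> cut_edges G P R")
    case True
    then obtain u v where uv: "e \<in> edges G" "fst e = {u, v}" "u \<in> P" "v \<notin> R"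
      by (auto simp: cut_edges_def)
    then have "e \<in> incident G v" by (simp add: incident_def)
    then have "v \<in> verts G" using mgraph_wf_edge[OF wf] by metis
    moreover have "fst e - R = {v}" using uv assms(2) by auto
    ultimately have "\<sigma> (the_elem (fst e - R)) = \<sigma>' (the_elem (fst e - R))"
      using uv assms(3,4) by (auto simp: agree_def)
    then show ?thesis by (simp add: cut_msgs_def)
  qed (simp add: cut_msgs_def)
qed

definition transcripts :: "nat \<Rightarrow> edge set \<Rightarrow> (edge \<Rightarrow> bool list) set" where
  "transcripts B X = PiE_dflt X [] (\<lambda>_. {bs. length bs \<le> B})"

lemma cut_msgs_transcripts:
  "(\<And>s e. length (msg A s e) \<le> B) \<Longrightarrow> cut_msgs A G P R \<sigma> \<in> transcripts B (cut_edges G P R)"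
  by (simp add: transcripts_def PiE_dflt_def cut_msgs_def)

lemma transcripts_nonempty: "transcripts B X \<noteq> {}"
  by (auto simp: transcripts_def intro: exI[of _ "[]"])

lemma card_bool_lists_le: "finite {bs :: bool list. length bs \<le> B}"
  "card {bs :: bool list. length bs \<le> B} \<le> 2 ^ (B + 1)"
proof -
  show "finite {bs :: bool list. length bs \<le> B}"
    using finite_lists_length_le[of "UNIV :: bool set" B] by simp
  have "card {bs :: bool list. length bs \<le> B} = (\<Sum>i\<le>B. 2 ^ i)"
    using card_lists_length_le[of "UNIV :: bool set" B] by simp
  also have "\<dots> \<le> 2 ^ (B + 1)" by (induction B) auto
  finally show "card {bs :: bool list. length bs \<le> B} \<le> 2 ^ (B + 1)" .
qed

lemma finite_transcripts: "finite X \<Longrightarrow> finite (transcripts B X)"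
  unfolding transcripts_def using card_bool_lists_le by blast

lemma card_transcripts_le:
  assumes "finite X" "card X \<le> N"
  shows "card (transcripts B X) \<le> 2 ^ ((B + 1) * N)"
proof -
  have "card (transcripts B X) = card {bs :: bool list. length bs \<le> B} ^ card X"
    unfolding transcripts_def using assms card_bool_lists_le(1) by (subst card_PiE_dflt) auto
  also have "\<dots> \<le> (2 ^ (B + 1)) ^ card X" by (intro power_mono card_bool_lists_le) simp
  also have "\<dots> \<le> (2 ^ (B + 1)) ^ N" by (intro power_increasing assms) simp
  finally show ?thesis by (simp only: power_mult)
qed

lemma rect_mixture_round:
  fixes A :: "'s congest_alg" and F :: "'x \<Rightarrow> 'y \<Rightarrow> (nat \<Rightarrow> 's) \<Rightarrow> ennreal"
  assumes wf: "mgraph_wf G" and B: "\<And>s e. length (msg A s e) \<le> B"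
    and F: "rect_mixture C PA PB F"
    and regions: "PA \<subseteq> RA" "PB \<subseteq> RB" "PA \<union> PB = verts G" "RA \<union> RB = verts G"
    and cut: "card (cut_edges G PA RA) \<le> N" "card (cut_edges G PB RB) \<le> N"
  shows "\<exists>C'\<le>C * 2 ^ (2 * (B + 1) * N). rect_mixture C' RA RB
    (\<lambda>x y \<sigma>. \<integral>\<^sup>+\<sigma>'. F x y \<sigma>' \<partial>measure_pmf (Pi_pmf (verts G) undefined (vertex_step A G \<sigma>)))"
proof -
  let ?Q = "\<lambda>P R. transcripts B (cut_edges G P R)"
  have fin: "finite (cut_edges G P R)" for P R
    using wf by (auto simp: cut_edges_def mgraph_wf_def)
  have *: "rect_mixture (C * (card (?Q PA RA) * card (?Q PB RB))) RA RB
    (\<lambda>x y \<sigma>. \<integral>\<^sup>+\<sigma>'. F x y \<sigma>' \<partial>measure_pmf (Pi_pmf (verts G) undefined (vertex_step A G \<sigma>)))"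
  proof (rule rect_mixture_step[OF F, where \<rho>="\<lambda>_. cut_msgs A G PA RA" and \<mu>="\<lambda>_. cut_msgs A G PB RB"
        and KA="\<lambda>_. sim_step A G PA RA" and KB="\<lambda>_. sim_step A G PB RB"])
    show "cut_msgs A G PA RA \<sigma> = cut_msgs A G PA RA \<sigma>'" if "agree RB \<sigma> \<sigma>'" for \<sigma> \<sigma>'
      using that regions by (intro cut_msgs_agree[OF wf]) auto
    show "cut_msgs A G PB RB \<sigma> = cut_msgs A G PB RB \<sigma>'" if "agree RA \<sigma> \<sigma>'" for \<sigma> \<sigma>'
      using that regions by (intro cut_msgs_agree[OF wf]) auto
  qed (use wf regions fin in \<open>auto simp: finite_transcripts transcripts_nonempty mgraph_wf_def
      intro: cut_msgs_transcripts[OF B] vertex_step_sim_step[OF wf] sim_step_agree[OF wf]\<close>)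
  have "card (?Q PA RA) * card (?Q PB RB) \<le> 2 ^ ((B + 1) * N) * 2 ^ ((B + 1) * N)"
    by (intro mult_le_mono card_transcripts_le fin cut)
  moreover have "2 * (B + 1) * N = (B + 1) * N + (B + 1) * N" by simp
  ultimately have "C * (card (?Q PA RA) * card (?Q PB RB)) \<le> C * 2 ^ (2 * (B + 1) * N)"
    by (intro mult_le_mono2) (simp only: power_add)
  with * show ?thesis by blast
qed

lemma rect_mixture_init:
  fixes A :: "'s congest_alg" and F :: "'x \<Rightarrow> 'y \<Rightarrow> (nat \<Rightarrow> 's) \<Rightarrow> ennreal"
  assumes V: "finite V" "V = PA \<union> PB"
    and F: "rect_mixture C PA PB F"
    and view: "\<And>x y v. v \<in> PA \<Longrightarrow> local_view (\<G> x y) v = viewA x v"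
      "\<And>x y v. v \<in> PB \<Longrightarrow> local_view (\<G> x y) v = viewB y v"
  shows "rect_mixture C {} {} (\<lambda>x y (\<sigma> :: nat \<Rightarrow> 's). \<integral>\<^sup>+\<sigma>'. F x y \<sigma>'
    \<partial>measure_pmf (Pi_pmf V undefined (\<lambda>v. init A v (local_view (\<G> x y) v))))"
proof -
  have "rect_mixture (C * (card {()} * card {()})) {} {} (\<lambda>x y (\<sigma> :: nat \<Rightarrow> 's). \<integral>\<^sup>+\<sigma>'. F x y \<sigma>'
    \<partial>measure_pmf (Pi_pmf V undefined (\<lambda>v. init A v (local_view (\<G> x y) v))))"
    by (rule rect_mixture_step[OF F V, where \<rho>="\<lambda>_ _. ()" and \<mu>="\<lambda>_ _. ()"
        and KA="\<lambda>x _ _ v. init A v (viewA x v)" and KB="\<lambda>y _ _ v. init A v (viewB y v)"])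
      (simp_all add: view)
  then show ?thesis by simp
qed

section \<open>The lower bound instances\<close>

lemma k_edge_connected_parallel:
  assumes "k \<ge> 1" and par: "\<And>u v \<kappa>. (u, v) \<in> R \<Longrightarrow> \<kappa> < k \<Longrightarrow> ({u, v}, \<kappa>) \<in> E"
    and conn: "\<And>u v. u \<in> V \<Longrightarrow> v \<in> V \<Longrightarrow> (u, v) \<in> R\<^sup>*"
  shows "k_edge_connected k V E"
  unfolding k_edge_connected_def connected_on_def
proof (intro allI impI ballI)
  fix X u v assume X: "X \<subseteq> E" "finite X \<and> card X \<le> k - 1" and uv: "u \<in> V" "v \<in> V"
  have "R \<subseteq> adj (E - X)"
  proof
    fix z assume "z \<in> R"
    then obtain u v where z: "z = (u, v)" "(u, v) \<in> R" by (cases z) auto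
    have "\<not> (\<lambda>\<kappa>. ({u, v}, \<kappa>)) ` {..<k} \<subseteq> X"
    proof
      assume "(\<lambda>\<kappa>. ({u, v}, \<kappa>)) ` {..<k} \<subseteq> X"
      then have "card ((\<lambda>\<kappa>. ({u, v}, \<kappa>)) ` {..<k}) \<le> card X" using X by (intro card_mono) auto
      moreover have "card ((\<lambda>\<kappa>. ({u, v}, \<kappa>)) ` {..<k}) = k"
        by (subst card_image) (auto simp: inj_on_def)
      ultimately show False using X assms(1) by linarith
    qed
    then obtain \<kappa> where "\<kappa> < k" "({u, v}, \<kappa>) \<notin> X" by auto
    then show "z \<in> adj (E - X)" using par[OF z(2)] z(1) by (auto simp: adj_def)
  qed
  then show "(u, v) \<in> (adj (E - X))\<^sup>*" using conn[OF uv] rtrancl_mono by blast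
qed

lemma k_edge_connected_connected: "k_edge_connected k V E \<Longrightarrow> connected_on V E"
  unfolding k_edge_connected_def by (elim allE[of _ "{}"]) simp

lemma rtrancl_map_rel:
  assumes "(x, y) \<in> r\<^sup>*" "\<And>x y. (x, y) \<in> r \<Longrightarrow> (h x, h y) \<in> s"
  shows "(h x, h y) \<in> s\<^sup>*"
  using assms(1) by (induction rule: rtrancl_induct) (auto intro: rtrancl_into_rtrancl assms(2))

locale lower_bound_instance = topology +
  fixes k n :: nat and g :: "nat \<Rightarrow> vx"
  assumes k_pos: "k \<ge> 1" and bij: "bij_betw g {..<n} vertex_set"
begin

definition graph :: "nat set \<Rightarrow> nat set \<Rightarrow> mgraph" where
  "graph x y = \<lparr>verts = {..<n},
     edges = {({u, v}, \<kappa>) | u v \<kappa>. u < n \<and> v < n \<and> lnk (g u) (g v) \<and> \<kappa> < k},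
     weight = (\<lambda>e. if \<exists>u v. fst e = {u, v} \<and> light x y (g u) (g v) then 0 else 1)\<rparr>"

abbreviation graph0 :: mgraph where
  "graph0 \<equiv> graph {} {}"

lemma verts_graph [simp]: "verts (graph x y) = {..<n}"
  and order_graph [simp]: "order (graph x y) = n"
  and edges_graph: "edges (graph x y) = edges graph0"
  by (simp_all add: graph_def order_def)

lemma incident_graph: "incident (graph x y) = incident graph0"
  by (rule incident_cong[OF edges_graph])

lemma g_vertex: "u < n \<Longrightarrow> g u \<in> vertex_set"
  using bij by (auto simp: bij_betw_def)

definition f :: "vx \<Rightarrow> nat" where
  "f = inv_into {..<n} g"

lemma f_g: "u < n \<Longrightarrow> f (g u) = u"
  using bij by (simp add: f_def bij_betw_def inv_into_f_f)

lemma g_f: "v \<in> vertex_set \<Longrightarrow> g (f v) = v" and f_less: "v \<in> vertex_set \<Longrightarrow> f v < n"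
  using bij bij_betw_inv_into_right[OF bij] bij_betw_inv_into[OF bij]
  by (auto simp: f_def bij_betw_def)

lemma edge_iff: "({u, v}, \<kappa>) \<in> edges graph0 \<longleftrightarrow> u < n \<and> v < n \<and> lnk (g u) (g v) \<and> \<kappa> < k"
  using lnk_sym by (auto simp: graph_def doubleton_eq_iff)

lemma graph_edge_cases:
  assumes "e \<in> edges graph0"
  obtains u v \<kappa> where "e = ({u, v}, \<kappa>)" "u < n" "v < n" "u \<noteq> v" "lnk (g u) (g v)" "\<kappa> < k"
proof -
  obtain u v \<kappa> where "e = ({u, v}, \<kappa>)" "u < n" "v < n" "lnk (g u) (g v)" "\<kappa> < k"
    using assms by (auto simp: graph_def)
  moreover from this have "u \<noteq> v" using lnk_irrefl by auto
  ultimately show ?thesis using that by blast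
qed

lemma adj_graph: "(u, v) \<in> adj (edges graph0) \<longleftrightarrow> u < n \<and> v < n \<and> lnk (g u) (g v)"
  using k_pos by (auto simp: adj_def edge_iff intro: exI[of _ 0])

lemma n_pos: "n > 0"
proof -
  have "Pth 0 \<in> vertex_set" by (simp add: vertex_set_def)
  then show ?thesis using f_less by fastforce
qed

lemma wf_graph: "mgraph_wf (graph x y)"
  unfolding mgraph_wf_def edges_graph[of x y]
proof (intro conjI)
  have "edges graph0 \<subseteq> (\<lambda>(u, v, \<kappa>). ({u, v}, \<kappa>)) ` ({..<n} \<times> {..<n} \<times> {..<k})"
  proof
    fix e assume "e \<in> edges graph0"
    then obtain u v \<kappa> where "e = ({u, v}, \<kappa>)" "u < n" "v < n" "\<kappa> < k" by (rule graph_edge_cases)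
    then show "e \<in> (\<lambda>(u, v, \<kappa>). ({u, v}, \<kappa>)) ` ({..<n} \<times> {..<n} \<times> {..<k})"
      by (intro image_eqI[of _ _ "(u, v, \<kappa>)"]) simp_all
  qed
  then show "finite (edges graph0)" by (rule finite_subset) simp
  show "\<forall>(S, j)\<in>edges graph0. S \<subseteq> verts (graph x y) \<and> card S = 2"
    by (auto elim!: graph_edge_cases)
  show "\<forall>S j. (S, Suc j) \<in> edges graph0 \<longrightarrow> (S, j) \<in> edges graph0"
    by (auto elim!: graph_edge_cases simp: edge_iff)
qed (use n_pos in auto)

lemma relpow_adj:
  "(u, v) \<in> {(u, v). lnk u v} ^^ i \<Longrightarrow> (f u, f v) \<in> adj (edges graph0) ^^ i"
proof (induction i arbitrary: v)
  case (Suc i)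
  then obtain w where w: "(u, w) \<in> {(u, v). lnk u v} ^^ i" "lnk w v" by auto
  then have "w \<in> vertex_set" "v \<in> vertex_set" using lnk_vertex_set by auto
  then have "(f w, f v) \<in> adj (edges graph0)" using w(2) by (simp add: adj_graph f_less g_f)
  then show ?case using Suc.IH[OF w(1)] by auto
qed simp

lemma adj_relpow_le:
  assumes "u < n" "v < n"
  shows "\<exists>i\<le>D. (u, v) \<in> adj (edges graph0) ^^ i"
proof -
  obtain i where "i \<le> D" "(g u, g v) \<in> {(u, v). lnk u v} ^^ i"
    using near_diameter[OF g_vertex g_vertex] assms unfolding near_def by blast
  then show ?thesis using relpow_adj[of "g u" "g v" i] assms by (auto simp: f_g)
qed

lemma potential_relpow:
  "(u, v) \<in> adj (edges graph0) ^^ i \<Longrightarrow> potential (g v) \<le> potential (g u) + i"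
proof (induction i arbitrary: v)
  case (Suc i)
  then obtain w where "(u, w) \<in> adj (edges graph0) ^^ i" "(w, v) \<in> adj (edges graph0)" by auto
  then show ?case using Suc.IH[of w] potential_lnk[of "g w" "g v"] by (auto simp: adj_graph)
qed simp

lemma diameter_graph: "diameter (graph x y) = D"
proof -
  let ?d = "hop_dist (graph x y)"
  have le: "?d u v \<le> D" if uv: "u < n" "v < n" for u v
  proof -
    obtain i where i: "i \<le> D" "(u, v) \<in> adj (edges graph0) ^^ i" using adj_relpow_le[OF uv] by blast
    have "?d u v \<le> i" unfolding hop_dist_def edges_graph[of x y] by (rule Least_le) (rule i(2))
    then show ?thesis using i(1) by simp
  qed
  have P: "Pth 0 \<in> vertex_set" "Pth D \<in> vertex_set" by (auto simp: vertex_set_def)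
  obtain i where "(f (Pth 0), f (Pth D)) \<in> adj (edges graph0) ^^ i"
    using adj_relpow_le f_less P by blast
  then have "(f (Pth 0), f (Pth D)) \<in> adj (edges graph0) ^^ ?d (f (Pth 0)) (f (Pth D))"
    unfolding hop_dist_def edges_graph[of x y] by (rule LeastI)
  then have "D \<le> ?d (f (Pth 0)) (f (Pth D))"
    using potential_relpow by (fastforce simp: g_f P)
  then have eq: "?d (f (Pth 0)) (f (Pth D)) = D"
    using le f_less P by (intro antisym) auto
  show ?thesis
    unfolding diameter_def
  proof (intro Max_eqI)
    show "D \<in> (\<lambda>(u, v). ?d u v) ` (verts (graph x y) \<times> verts (graph x y))"
      using f_less P eq by (intro image_eqI[of _ _ "(f (Pth 0), f (Pth D))"]) simp_all
  qed (use le in auto)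
qed

lemma rtrancl_graph:
  assumes "u < n" "v < n" "(g u, g v) \<in> {(a, b). R a b}\<^sup>*" "\<And>a b. R a b \<Longrightarrow> lnk a b"
  shows "(u, v) \<in> {(u, v). u < n \<and> v < n \<and> R (g u) (g v)}\<^sup>*"
proof -
  have "(f (g u), f (g v)) \<in> {(u, v). u < n \<and> v < n \<and> R (g u) (g v)}\<^sup>*"
  proof (rule rtrancl_map_rel[OF assms(3)])
    fix a b assume "(a, b) \<in> {(a, b). R a b}"
    then show "(f a, f b) \<in> {(u, v). u < n \<and> v < n \<and> R (g u) (g v)}"
      using lnk_vertex_set[OF assms(4)] by (auto simp: f_less g_f)
  qed
  then show ?thesis using assms(1,2) by (simp add: f_g)
qed

lemma graph_input:
  assumes "1 \<le> a"
  shows "graph x y \<in> kecss_inputs k a b"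
proof -
  have "k_edge_connected k {..<n} (edges graph0)"
  proof (rule k_edge_connected_parallel[OF k_pos, where R="adj (edges graph0)"])
    fix u v assume "u \<in> {..<n}" "v \<in> {..<n}"
    then show "(u, v) \<in> (adj (edges graph0))\<^sup>*"
      using adj_relpow_le[of u v] relpow_imp_rtrancl by blast
  qed (simp add: adj_graph edge_iff)
  moreover have "v < n ^ a" if "v < n" for v
    using that power_increasing[of 1 a n] assms by auto
  moreover have "weight (graph x y) e \<le> n ^ b" for e
    using n_pos by (simp add: graph_def)
  ultimately show ?thesis
    by (simp add: kecss_inputs_def wf_graph edges_graph[of x y])
qed

subsection \<open>Optimal solutions\<close>

lemma weight_zero_iff:
  "({u, v}, \<kappa>) \<in> edges graph0 \<Longrightarrow> weight (graph x y) ({u, v}, \<kappa>) = 0 \<longleftrightarrow> light x y (g u) (g v)"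
  using light_sym by (auto simp: graph_def doubleton_eq_iff)

lemma opt_cost_even:
  assumes "x \<subseteq> {..<m}" "even (card (x \<inter> y))"
  shows "opt_cost k (graph x y) = 0"
proof -
  let ?F = "{e \<in> edges graph0. weight (graph x y) e = 0}"
  have "k_edge_connected k {..<n} ?F"
  proof (rule k_edge_connected_parallel[OF k_pos,
        where R="{(u, v). u < n \<and> v < n \<and> light x y (g u) (g v)}"])
    fix u v assume "u \<in> {..<n}" "v \<in> {..<n}"
    then have uv: "u < n" "v < n" by auto
    have "lconn x y (g u) (g v)"
      using lconn_trans[OF lconn_even[OF assms g_vertex] lconn_sym[OF lconn_even[OF assms g_vertex]]] uv
      by blast
    then show "(u, v) \<in> {(u, v). u < n \<and> v < n \<and> light x y (g u) (g v)}\<^sup>*"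
      using light_lnk unfolding lconn_def by (intro rtrancl_graph uv)
  next
    fix u v \<kappa> assume uv: "(u, v) \<in> {(u, v). u < n \<and> v < n \<and> light x y (g u) (g v)}" "\<kappa> < k"
    then have "({u, v}, \<kappa>) \<in> edges graph0" using light_lnk by (auto simp: edge_iff)
    then show "({u, v}, \<kappa>) \<in> ?F" using uv weight_zero_iff by auto
  qed
  then have ecss: "k_ecss k (graph x y) ?F" by (simp add: k_ecss_def edges_graph[of x y])
  have "finite {F. k_ecss k (graph x y) F}"
    using wf_graph[of x y] by (auto simp: k_ecss_def mgraph_wf_def)
  moreover have "cost (graph x y) ?F = 0" by (simp add: cost_def)
  ultimately have "opt_cost k (graph x y) \<le> 0"
    unfolding opt_cost_def using ecss by (intro Min_le) (auto intro!: image_eqI[of 0 _ ?F])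
  then show ?thesis by simp
qed

lemma ecss_odd:
  assumes "x \<subseteq> {..<m}" "odd (card (x \<inter> y))" "k_ecss k (graph x y) F"
  shows "\<exists>e\<in>F. weight (graph x y) e \<noteq> 0"
proof (rule ccontr)
  assume "\<not> ?thesis"
  then have zero: "\<And>e. e \<in> F \<Longrightarrow> weight (graph x y) e = 0" by blast
  have F: "F \<subseteq> edges graph0" "connected_on {..<n} F"
    using assms(3) k_edge_connected_connected by (auto simp: k_ecss_def edges_graph[of x y])
  let ?u = "Col 0 False True 0" and ?v = "Tr 0 0"
  have uv: "?u \<in> vertex_set" "?v \<in> vertex_set" by (auto simp: vertex_set_def)
  have "(f ?u, f ?v) \<in> (adj F)\<^sup>*"
    using F(2) f_less uv by (auto simp: connected_on_def)
  then have "(g (f ?u), g (f ?v)) \<in> {(u, v). light x y u v}\<^sup>*"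
  proof (rule rtrancl_map_rel)
    fix u v assume "(u, v) \<in> adj F"
    then obtain \<kappa> where "({u, v}, \<kappa>) \<in> F" by (auto simp: adj_def)
    then show "(g u, g v) \<in> {(u, v). light x y u v}"
      using F(1) zero weight_zero_iff[of u v \<kappa> x y] by auto
  qed
  then show False
    using not_lconn_odd[OF assms(1,2)] by (simp add: lconn_def g_f uv)
qed

subsection \<open>Simulation\<close>

definition areg :: "nat \<Rightarrow> nat set" where "areg \<tau> = {v. v < n \<and> inA \<tau> (g v)}"
definition breg :: "nat \<Rightarrow> nat set" where "breg \<tau> = {v. v < n \<and> inB \<tau> (g v)}"

lemma areg_Suc: "areg (Suc \<tau>) \<subseteq> areg \<tau>" and breg_Suc: "breg (Suc \<tau>) \<subseteq> breg \<tau>"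
  using inA_Suc inB_Suc by (auto simp: areg_def breg_def)

lemma areg_0: "areg \<tau> \<subseteq> areg 0" and breg_0: "breg \<tau> \<subseteq> breg 0"
  using areg_Suc breg_Suc by (induction \<tau>; blast)+

lemma areg_breg: "2 * \<tau> < l \<Longrightarrow> areg \<tau> \<union> breg \<tau> = {..<n}"
  using inA_or_inB by (auto simp: areg_def breg_def)

lemma card_cut_le:
  assumes "\<And>u v. u < n \<Longrightarrow> v < n \<Longrightarrow> lnk (g u) (g v) \<Longrightarrow> u \<in> P \<Longrightarrow> v \<notin> R \<Longrightarrow>
      \<exists>j<d. g u = h j \<and> g v = h' j"
  shows "card (cut_edges graph0 P R) \<le> d * k"
proof -
  let ?e = "\<lambda>(j, \<kappa>). ({f (h j), f (h' j)}, \<kappa>)"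
  have "cut_edges graph0 P R \<subseteq> ?e ` ({..<d} \<times> {..<k})"
  proof
    fix e assume "e \<in> cut_edges graph0 P R"
    then obtain u v where uv: "e \<in> edges graph0" "fst e = {u, v}" "u \<in> P" "v \<notin> R"
      by (auto simp: cut_edges_def)
    then have e: "e = ({u, v}, snd e)" by (metis prod.collapse)
    then have *: "u < n" "v < n" "lnk (g u) (g v)" "snd e < k" using uv(1) edge_iff by metis+
    then obtain j where "j < d" "g u = h j" "g v = h' j" using assms uv by blast
    then show "e \<in> ?e ` ({..<d} \<times> {..<k})"
      using * e f_g by (intro image_eqI[of _ _ "(j, snd e)"]) (auto, metis)
  qed
  then have "card (cut_edges graph0 P R) \<le> card (?e ` ({..<d} \<times> {..<k}))"
    by (intro card_mono) auto
  also have "\<dots> \<le> card ({..<d} \<times> {..<k})" by (rule card_image_le) simp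
  finally show ?thesis by simp
qed

lemma card_cut_areg: "\<tau> < l \<Longrightarrow> card (cut_edges graph0 (areg (Suc \<tau>)) (areg \<tau>)) \<le> d * k"
  by (rule card_cut_le[where h="\<lambda>j. Tr (Suc j) ((l - \<tau> - 1) div 2 ^ Suc j)"
        and h'="\<lambda>j. Tr j (2 * ((l - \<tau> - 1) div 2 ^ Suc j) + 1)"])
    (use inA_crossing in \<open>auto simp: areg_def simp del: power_Suc\<close>)

lemma card_cut_breg: "\<tau> < l \<Longrightarrow> card (cut_edges graph0 (breg (Suc \<tau>)) (breg \<tau>)) \<le> d * k"
  by (rule card_cut_le[where h="\<lambda>j. Tr (Suc j) ((\<tau> + 1) div 2 ^ Suc j)"
        and h'="\<lambda>j. Tr j (2 * ((\<tau> + 1) div 2 ^ Suc j))"])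
    (use inB_crossing in \<open>auto simp: breg_def simp del: power_Suc\<close>)

lemma weight_areg:
  assumes "v \<in> areg \<tau>" "e \<in> incident graph0 v"
  shows "weight (graph x y) e = weight (graph x {}) e"
proof -
  have v: "inA 0 (g v)" using assms(1) areg_0 by (auto simp: areg_def)
  have "light x y (g a) (g b) \<longleftrightarrow> light x {} (g a) (g b)" if "fst e = {a, b}" for a b
  proof -
    have "v = a \<or> v = b" using that assms(2) by (auto simp: incident_def)
    then show ?thesis using v unfolding light_def by (metis arc_inA)
  qed
  then show ?thesis by (auto simp: graph_def)
qed

lemma weight_breg:
  assumes "v \<in> breg \<tau>" "e \<in> incident graph0 v"
  shows "weight (graph x y) e = weight (graph {} y) e"
proof -
  have v: "inB 0 (g v)" using assms(1) breg_0 by (auto simp: breg_def)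
  have "light x y (g a) (g b) \<longleftrightarrow> light {} y (g a) (g b)" if "fst e = {a, b}" for a b
  proof -
    have "v = a \<or> v = b" using that assms(2) by (auto simp: incident_def)
    then show ?thesis using v unfolding light_def by (metis arc_inB)
  qed
  then show ?thesis by (auto simp: graph_def)
qed

lemma local_view_areg:
  "v \<in> areg \<tau> \<Longrightarrow> local_view (graph x y) v = local_view (graph x {}) v"
  unfolding local_view_def incident_graph[of x y] incident_graph[of x "{}"]
  by (intro ext) (simp add: restrict_map_def weight_areg[of v \<tau> _ x y])

lemma local_view_breg:
  "v \<in> breg \<tau> \<Longrightarrow> local_view (graph x y) v = local_view (graph {} y) v"
  unfolding local_view_def incident_graph[of x y] incident_graph[of "{}" y]
  by (intro ext) (simp add: restrict_map_def weight_breg[of v \<tau> _ x y])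

lemma run_Suc_graph: "run A (graph x y) (Suc t) =
    run A (graph x y) t \<bind> (\<lambda>\<sigma>. Pi_pmf (verts graph0) undefined (vertex_step A graph0 \<sigma>))"
  using vertex_step_cong[OF edges_graph[of x y], of A] by simp

lemma rect_mixture_run:
  fixes A :: "'s congest_alg" and F :: "nat set \<Rightarrow> nat set \<Rightarrow> (nat \<Rightarrow> 's) \<Rightarrow> ennreal"
  assumes B: "\<And>s e. length (msg A s e) \<le> B"
    and "2 * T < l" and "rect_mixture C (areg T) (breg T) F"
  shows "\<exists>C'\<le>C * 2 ^ (2 * (B + 1) * (d * k) * T). rect_mixture C' {} {}
    (\<lambda>x y (\<sigma> :: nat \<Rightarrow> 's). \<integral>\<^sup>+\<sigma>'. F x y \<sigma>' \<partial>measure_pmf (run A (graph x y) T))"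
  using assms(2,3)
proof (induction T arbitrary: C F)
  case 0
  have "rect_mixture C {} {} (\<lambda>x y (\<sigma> :: nat \<Rightarrow> 's). \<integral>\<^sup>+\<sigma>'. F x y \<sigma>'
      \<partial>measure_pmf (Pi_pmf {..<n} undefined (\<lambda>v. init A v (local_view (graph x y) v))))"
    using areg_breg[OF "0.prems"(1)]
    by (intro rect_mixture_init[OF _ _ "0.prems"(2)]) (auto intro: local_view_areg local_view_breg)
  then show ?case by auto
next
  case (Suc T)
  obtain C1 where C1: "C1 \<le> C * 2 ^ (2 * (B + 1) * (d * k))"
    "rect_mixture C1 (areg T) (breg T) (\<lambda>x y \<sigma>. \<integral>\<^sup>+\<sigma>'. F x y \<sigma>'
        \<partial>measure_pmf (Pi_pmf (verts graph0) undefined (vertex_step A graph0 \<sigma>)))"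
    using rect_mixture_round[OF wf_graph B Suc.prems(2) areg_Suc breg_Suc _ _ card_cut_areg card_cut_breg]
      areg_breg[of "Suc T"] areg_breg[of T] Suc.prems(1) by auto
  obtain C2 where C2: "C2 \<le> C1 * 2 ^ (2 * (B + 1) * (d * k) * T)"
    "rect_mixture C2 {} {} (\<lambda>x y (\<sigma> :: nat \<Rightarrow> 's). \<integral>\<^sup>+\<sigma>'. \<integral>\<^sup>+\<sigma>''. F x y \<sigma>''
        \<partial>measure_pmf (Pi_pmf (verts graph0) undefined (vertex_step A graph0 \<sigma>'))
        \<partial>measure_pmf (run A (graph x y) T))"
    using Suc.IH[OF _ C1(2)] Suc.prems(1) by auto
  have "C2 \<le> C * 2 ^ (2 * (B + 1) * (d * k)) * 2 ^ (2 * (B + 1) * (d * k) * T)"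
    using C1(1) C2(1) by (meson le_trans mult_le_mono1)
  also have "\<dots> = C * 2 ^ (2 * (B + 1) * (d * k) * Suc T)"
    by (simp only: mult_Suc_right power_add mult.assoc)
  finally show ?case
    using C2(2) by (intro exI[of _ C2]) (simp add: run_Suc_graph del: run.simps(2))
qed

definition no_heavy :: "'s congest_alg \<Rightarrow> nat set \<Rightarrow> nat set \<Rightarrow> nat set \<Rightarrow> (nat \<Rightarrow> 's) set" where
  "no_heavy A V x y = {\<sigma>. \<forall>v\<in>V. \<forall>X e. output A (\<sigma> v) = Some X \<longrightarrow> e \<in> X \<inter> incident graph0 v \<longrightarrow>
     weight (graph x y) e = 0}"

lemma rect_mixture_no_heavy:
  assumes "2 * T < l"
  shows "rect_mixture 1 (areg T) (breg T) (\<lambda>x y \<sigma>. indicator (no_heavy A {..<n} x y) \<sigma>)"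
proof -
  let ?a = "\<lambda>x \<sigma>. indicator (no_heavy A (areg T) x {}) \<sigma> :: ennreal"
  let ?b = "\<lambda>y \<sigma>. indicator (no_heavy A (breg T) {} y) \<sigma> :: ennreal"
  have a: "no_heavy A (areg T) x {} = no_heavy A (areg T) x y" for x y
    unfolding no_heavy_def
    by (intro Collect_cong ball_cong refl all_cong1 imp_cong) (simp add: weight_areg[of _ T _ x y])
  have b: "no_heavy A (breg T) {} y = no_heavy A (breg T) x y" for x y
    unfolding no_heavy_def
    by (intro Collect_cong ball_cong refl all_cong1 imp_cong) (simp add: weight_breg[of _ T _ x y])
  have "no_heavy A {..<n} x y = no_heavy A (areg T) x {} \<inter> no_heavy A (breg T) {} y" for x y
    unfolding a[of x y] b[of y x] unfolding no_heavy_def areg_breg[OF assms, symmetric] by blast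
  then have "(\<lambda>x y \<sigma>. indicator (no_heavy A {..<n} x y) \<sigma>) = (\<lambda>x y \<sigma>. ?a x \<sigma> * ?b y \<sigma>)"
    by (simp add: indicator_inter_arith fun_eq_iff)
  moreover have "local_factor (areg T) ?a" "local_factor (breg T) ?b"
    by (auto simp: local_factor_def agree_def no_heavy_def indicator_def)
  ultimately show ?thesis
    using rect_mixture_product[of "areg T" ?a "breg T" ?b] by simp
qed


subsection \<open>The lower bound for an instance\<close>

lemma prob_no_heavy:
  assumes alg: "kecss_approx_alg k \<alpha> c (kecss_inputs k a b) A" and "1 \<le> a"
    and T: "rounds c A (graph x y) \<le> enat T" and x: "x \<subseteq> {..<m}"
  shows "even (card (x \<inter> y)) \<Longrightarrow>
      1 - 2 / real n powr c \<le> measure_pmf.prob (run A (graph x y) T) (no_heavy A {..<n} x y)"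
    and "odd (card (x \<inter> y)) \<Longrightarrow>
      measure_pmf.prob (run A (graph x y) T) (no_heavy A {..<n} x y) \<le> 2 / real n powr c"
proof -
  let ?G = "graph x y" and ?P = "measure_pmf.prob (run A (graph x y) T)"
  define S where "S = {\<sigma>. \<exists>F. outputs A ?G \<sigma> F \<and> k_ecss k ?G F \<and>
      real (cost ?G F) \<le> \<alpha> (order ?G) * real (opt_cost k ?G)}"
  have S: "1 - 2 / real n powr c \<le> ?P S"
  proof -
    have "2 * high_prob c ?G - 1 \<le> ?P S"
    proof (rule prob_success_at_termination[OF wf_graph _ T])
      show "high_prob c ?G \<le> (SUP t. measure_pmf.prob (run A ?G t) S)"
        using alg graph_input[OF assms(2)] unfolding kecss_approx_alg_def S_def by blast
    qed (auto simp: S_def outputs_def terminated_def)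
    then show ?thesis by (simp add: high_prob_def)
  qed
  have out: "weight ?G e = 0" if \<sigma>: "outputs A ?G \<sigma> F" "\<sigma> \<in> no_heavy A {..<n} x y" "F \<subseteq> edges graph0" "e \<in> F" for \<sigma> F e
  proof -
    obtain u v \<kappa> where e: "e = ({u, v}, \<kappa>)" "u < n"
      using \<sigma>(3,4) by (blast elim: graph_edge_cases)
    then have "e \<in> incident graph0 u" using e(1) \<sigma>(3,4) by (auto simp: incident_def)
    moreover have "output A (\<sigma> u) = Some (F \<inter> incident graph0 u)"
      using \<sigma>(1) e(2) by (simp add: outputs_def incident_graph[of x y])
    ultimately show ?thesis using \<sigma>(2,4) e(2) unfolding no_heavy_def by blast
  qed
  show "1 - 2 / real n powr c \<le> ?P (no_heavy A {..<n} x y)" if even: "even (card (x \<inter> y))"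
  proof -
    have "S \<subseteq> no_heavy A {..<n} x y"
    proof
      fix \<sigma> assume "\<sigma> \<in> S"
      then obtain F where F: "outputs A ?G \<sigma> F" "k_ecss k ?G F" "cost ?G F = 0"
        using opt_cost_even[OF x even] by (auto simp: S_def)
      then have "finite F"
        using wf_graph[of x y] by (auto simp: k_ecss_def mgraph_wf_def intro: finite_subset)
      then have "\<forall>e\<in>F. weight ?G e = 0" using F(3) by (simp add: cost_def)
      then show "\<sigma> \<in> no_heavy A {..<n} x y"
        using F(1) by (auto simp: no_heavy_def outputs_def)
    qed
    then have "?P S \<le> ?P (no_heavy A {..<n} x y)"
      by (intro measure_pmf.finite_measure_mono) auto
    then show ?thesis using S by linarith
  qed
  show "?P (no_heavy A {..<n} x y) \<le> 2 / real n powr c" if odd: "odd (card (x \<inter> y))"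
  proof -
    have "S \<inter> no_heavy A {..<n} x y = {}"
    proof (rule ccontr)
      assume "S \<inter> no_heavy A {..<n} x y \<noteq> {}"
      then obtain \<sigma> F where F: "\<sigma> \<in> no_heavy A {..<n} x y" "outputs A ?G \<sigma> F" "k_ecss k ?G F"
        by (auto simp: S_def)
      obtain e where "e \<in> F" "weight ?G e \<noteq> 0" using ecss_odd[OF x odd F(3)] by blast
      moreover have "F \<subseteq> edges graph0" using F(3) by (simp add: k_ecss_def edges_graph[of x y])
      ultimately show False using out[OF F(2,1)] by simp
    qed
    then have "?P (S \<union> no_heavy A {..<n} x y) = ?P S + ?P (no_heavy A {..<n} x y)"
      by (intro measure_pmf.finite_measure_Union) auto
    then show ?thesis
      using S measure_pmf.prob_le_1[of "run A ?G T" "S \<union> no_heavy A {..<n} x y"] by linarith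
  qed
qed

theorem rounds_lower_bound:
  assumes alg: "kecss_approx_alg k \<alpha> c (kecss_inputs k a b) A"
    and bw: "respects_bandwidth \<beta> (kecss_inputs k a b) A"
    and a: "1 \<le> a" and c: "1 \<le> c" and n: "16 \<le> n" and T: "2 * T < l"
    and m: "4 * (nat \<lfloor>\<beta> * log 2 (real n)\<rfloor> + 1) * (d * k) * T + 8 \<le> m"
  shows "enat T \<le> worst_case_rounds c (kecss_inputs k a b) A n D"
proof (rule ccontr)
  assume neg: "\<not> ?thesis"
  have rounds: "rounds c A (graph x y) \<le> enat T" for x y
  proof -
    have "rounds c A (graph x y) \<le> worst_case_rounds c (kecss_inputs k a b) A n D"
      unfolding worst_case_rounds_def
      using graph_input[OF a, of x y b] diameter_graph[of x y] by (intro SUP_upper) auto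
    then show ?thesis using neg by (meson le_cases order_trans)
  qed
  define B where "B = nat \<lfloor>\<beta> * log 2 (real n)\<rfloor>"
  define A' where "A' = truncate_msgs B A"
  have run: "run A' (graph x y) t = run A (graph x y) t" for x y t
    unfolding A'_def
  proof (rule run_truncate_msgs[OF wf_graph])
    fix t \<sigma> v e assume "\<sigma> \<in> set_pmf (run A (graph x y) t)" "v \<in> verts (graph x y)"
      "e \<in> incident (graph x y) v"
    then have "real (length (msg A (\<sigma> v) e)) \<le> \<beta> * log 2 (real n)"
      using bw graph_input[OF a, of x y b] unfolding respects_bandwidth_def by fastforce
    then show "length (msg A (\<sigma> v) e) \<le> B" unfolding B_def by linarith
  qed
  define P where "P x y = measure_pmf.prob (run A (graph x y) T) (no_heavy A {..<n} x y)" for x y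
  define E where "E = 2 * (B + 1) * (d * k) * T"
  have "length (msg A' s e) \<le> B" for s e by (simp add: A'_def msg_truncate_msgs)
  from rect_mixture_run[OF this T rect_mixture_no_heavy[OF T, of A]] obtain C where C: "C \<le> 2 ^ E"
    "rect_mixture C {} {} (\<lambda>x y (\<sigma> :: nat \<Rightarrow> 'a). ennreal (P x y))"
    by (auto simp: run E_def P_def measure_pmf.emeasure_eq_measure)
  define \<delta> where "\<delta> = 2 / real n powr c"
  have \<delta>: "\<delta> \<le> 1 / 8"
  proof -
    have "16 \<le> real n powr 1" using n by simp
    also have "\<dots> \<le> real n powr c" using n c by (intro powr_mono) auto
    finally show ?thesis using n by (simp add: \<delta>_def divide_le_eq)
  qed
  let ?S = "Pow {..<m}"
  define N where "N = (2 :: real) ^ m"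
  have N: "N > 0" by (simp add: N_def)
  have cardS: "(\<Sum>x\<in>?S. \<Sum>y\<in>?S. (1 :: real)) = N * N" by (simp add: card_Pow N_def)
  have "(1 + ip_sign x y) / 2 - \<delta> \<le> ip_sign x y * P x y" if "x \<in> ?S" for x y
  proof (cases "even (card (x \<inter> y))")
    case True
    then show ?thesis
      using prob_no_heavy(1)[OF alg a rounds, of x y] that by (simp add: ip_sign_def P_def \<delta>_def)
  next
    case False
    then show ?thesis
      using prob_no_heavy(2)[OF alg a rounds, of x y] that by (simp add: ip_sign_def P_def \<delta>_def)
  qed
  then have "(\<Sum>x\<in>?S. \<Sum>y\<in>?S. (1 + ip_sign x y) / 2 - \<delta>) \<le> (\<Sum>x\<in>?S. \<Sum>y\<in>?S. ip_sign x y * P x y)"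
    by (intro sum_mono)
  also have "\<dots> \<le> real C * (N * sqrt N)"
    using rect_mixture_discrepancy[OF C(2), of "{..<m}"] by (simp add: N_def P_def)
  also have "\<dots> \<le> 2 ^ E * (N * sqrt N)"
    using C(1) N by (intro mult_right_mono) (auto simp flip: of_nat_le_iff)
  finally have 1: "(\<Sum>x\<in>?S. \<Sum>y\<in>?S. (1 + ip_sign x y) / 2 - \<delta>) \<le> 2 ^ E * (N * sqrt N)" .
  have "(\<Sum>x\<in>?S. \<Sum>y\<in>?S. (1 + ip_sign x y) / 2 - \<delta>)
      = (1 / 2 - \<delta>) * (\<Sum>x\<in>?S. \<Sum>y\<in>?S. 1) + (\<Sum>x\<in>?S. \<Sum>y\<in>?S. ip_sign x y) / 2"
    by (simp add: sum.distrib sum_subtractf sum_divide_distrib[symmetric] add_divide_distrib algebra_simps)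
  moreover have "\<bar>\<Sum>x\<in>?S. \<Sum>y\<in>?S. ip_sign x y\<bar> \<le> N * sqrt N"
    using ip_discrepancy[of "{..<m}" "\<lambda>_. 1" "\<lambda>_. 1"] by (simp add: N_def)
  ultimately have "(1 / 2 - \<delta>) * (N * N) \<le> (2 ^ E + 1 / 2) * (N * sqrt N)"
    using 1 cardS by (simp add: algebra_simps)
  moreover have "3 / 8 * (N * N) \<le> (1 / 2 - \<delta>) * (N * N)"
    using \<delta> N by (intro mult_right_mono) auto
  ultimately have "3 / 8 * (N * N) \<le> (2 ^ E + 1 / 2) * (N * sqrt N)" by linarith
  moreover have "N * N = sqrt N * (N * sqrt N)" using N by simp
  ultimately have "3 / 8 * sqrt N * (N * sqrt N) \<le> (2 ^ E + 1 / 2) * (N * sqrt N)"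
    by (simp only: mult.assoc)
  then have le: "3 / 8 * sqrt N \<le> 2 ^ E + 1 / 2"
    using N by (subst (asm) mult_le_cancel_right_pos) auto
  have "2 * (E + 4) = 4 * (B + 1) * (d * k) * T + 8" by (simp add: E_def algebra_simps)
  then have "2 * (E + 4) \<le> m" using m by (simp only: B_def)
  then have "(2 :: real) ^ (2 * (E + 4)) \<le> N" unfolding N_def by (intro power_increasing) auto
  then have "2 ^ (E + 4) \<le> sqrt N" by (intro real_le_rsqrt) (simp add: power_mult[symmetric] mult.commute)
  then have "16 * 2 ^ E \<le> sqrt N" by (simp add: power_add)
  moreover have "(1 :: real) \<le> 2 ^ E" by simp
  ultimately show False using le by linarith
qed

end

section \<open>Choice of the parameters\<close>

lemma rounds_lower_bound_parameters:
  assumes alg: "kecss_approx_alg k \<alpha> c (kecss_inputs k a b) A"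
    and bw: "respects_bandwidth \<beta> (kecss_inputs k a b) A"
    and k: "1 \<le> k" and a: "1 \<le> a" and c: "1 \<le> c" and n: "16 \<le> n"
    and top: "1 \<le> m" "1 \<le> l" "d \<noteq> 0 \<Longrightarrow> l < 2 ^ d"
      "(if d = 0 then l + 1 else 2 * d + 1) + 1 \<le> D div 2"
    and size: "4 * (m + 1) * (l + 1) + (d + 1) * (l + 1) + (D + 1) \<le> n"
    and T: "2 * T < l"
    and m: "4 * (nat \<lfloor>\<beta> * log 2 (real n)\<rfloor> + 1) * (d * k) * T + 8 \<le> m"
  shows "enat T \<le> worst_case_rounds c (kecss_inputs k a b) A n D"
proof -
  have top': "topology m l d D" using top by unfold_locales auto
  define V where "V r = topology.vertex_set m l d D r" for r
  have core: "V r - range Lf = V 0 - range Lf" for r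
    unfolding V_def topology.vertex_set_def[OF top'] by auto
  define r where "r = n - card (V 0 - range Lf)"
  have "card (V r) = n"
    using topology.card_vertex_set[OF top', of r] topology.card_vertex_set_le[OF top', of 0] size core[of r]
    by (simp add: r_def flip: V_def)
  moreover have "finite (V r)" unfolding V_def by (rule topology.finite_vertex_set[OF top'])
  ultimately obtain g where "bij_betw g {..<n} (V r)"
    using ex_bij_betw_nat_finite[of "V r"] by (auto simp: atLeast0LessThan)
  then interpret lower_bound_instance m l d D r k n g
    using top k by unfold_locales (auto simp: V_def)
  show ?thesis by (rule rounds_lower_bound[OF alg bw a c n T m])
qed

lemma enat_lower_bound_real:
  assumes "enat T \<le> w" "r \<le> real T"
  shows "ereal r \<le> ereal_of_enat w"
proof -
  have "ereal r \<le> ereal_of_enat (enat T)" using assms(2) by simp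
  also have "\<dots> \<le> ereal_of_enat w" using assms(1) by (simp only: ereal_of_enat_le_iff)
  finally show ?thesis .
qed

lemma rounds_lower_bound_diameter:
  assumes alg: "kecss_approx_alg k \<alpha> c (kecss_inputs k a b) A"
    and bw: "respects_bandwidth \<beta> (kecss_inputs k a b) A"
    and k: "1 \<le> k" and a: "1 \<le> a" and c: "1 \<le> c"
    and D: "400 \<le> D" "2 * D \<le> n"
  shows "ereal (real D / 400) \<le> ereal_of_enat (worst_case_rounds c (kecss_inputs k a b) A n D)"
proof (rule enat_lower_bound_real)
  define l where "l = D div 40 - 1"
  have l: "l + 1 = D div 40" using D by (simp add: l_def)
  have "40 * (l + 1) \<le> D" unfolding l by simp
  then have "37 * (l + 1) + (D + 1) \<le> n" using D by linarith
  then have "4 * (8 + 1) * (l + 1) + (0 + 1) * (l + 1) + (D + 1) \<le> n" by simp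
  moreover have "2 * (l + 1 + 1) \<le> D" using \<open>40 * (l + 1) \<le> D\<close> D(1) by simp
  then have "l + 1 + 1 \<le> D div 2" by arith
  moreover have "2 * (D div 200) < l" using D(1) l by linarith
  ultimately show "enat (D div 200) \<le> worst_case_rounds c (kecss_inputs k a b) A n D"
    using D by (intro rounds_lower_bound_parameters[OF alg bw k a c, where d=0 and m=8 and l=l]) auto
  show "real D / 400 \<le> real (D div 200)" using D(1) by linarith
qed

lemma rounds_lower_bound_sqrt:
  fixes n :: nat and \<beta> :: real
  defines "L \<equiv> log 2 (real n)"
  defines "q \<equiv> sqrt (real n) / L"
  assumes alg: "kecss_approx_alg k \<alpha> c (kecss_inputs k a b) A"
    and bw: "respects_bandwidth \<beta> (kecss_inputs k a b) A"
    and k: "1 \<le> k" and a: "1 \<le> a" and c: "1 \<le> c" and \<beta>: "0 < \<beta>"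
    and L: "50 \<le> L" and q: "256 * (\<beta> + 1) * real k \<le> q"
    and D: "8 * L \<le> real D" "2 * D \<le> n"
  shows "ereal (q / (256 * (\<beta> + 1) * real k)) \<le> ereal_of_enat (worst_case_rounds c (kecss_inputs k a b) A n D)"
proof (rule enat_lower_bound_real)
  define K where "K = (\<beta> + 1) * real k"
  have "1 * 1 \<le> (\<beta> + 1) * real k" using \<beta> k by (intro mult_mono) auto
  then have K: "1 \<le> K" by (simp add: K_def)
  have qK: "256 * K \<le> q" using q by (simp add: K_def mult_ac)
  then have q256: "256 \<le> q" using K by linarith
  have n0: "real n > 0" using q256 by (cases n) (auto simp: q_def)
  have sq: "sqrt (real n) = q * L" using L by (simp add: q_def)
  have nq: "real n = (q * L) * (q * L)" using n0 by (simp flip: sq)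
  have qL: "256 * 50 \<le> q * L" using q256 L by (intro mult_mono) auto
  have qle: "q \<le> sqrt (real n)"
    using q256 L mult_left_mono[of 1 L q] by (simp add: sq)
  obtain d where "2 ^ d \<le> nat \<lfloor>q\<rfloor>" "nat \<lfloor>q\<rfloor> < 2 ^ (d + 1)"
    using ex_power_ivl1[of 2 "nat \<lfloor>q\<rfloor>"] q256 by (auto simp: le_nat_iff le_floor_iff)
  then have "real (2 ^ d) \<le> real (nat \<lfloor>q\<rfloor>)" "real (nat \<lfloor>q\<rfloor>) + 1 \<le> real (2 ^ (d + 1))"
    by linarith+
  moreover have "real (nat \<lfloor>q\<rfloor>) \<le> q" "q < real (nat \<lfloor>q\<rfloor>) + 1" using q256 by linarith+
  ultimately have d: "2 ^ d \<le> q" "q < 2 ^ (d + 1)"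
    unfolding of_nat_power of_nat_numeral by linarith+
  define l where "l = 2 ^ d - (1 :: nat)"
  define m where "m = nat \<lfloor>sqrt (real n) * L / 16\<rfloor>"
  define T where "T = nat \<lfloor>q / (128 * K)\<rfloor>"
  define B where "B = nat \<lfloor>\<beta> * L\<rfloor>"
  have dL: "2 * real d \<le> L"
  proof -
    have "(2 :: real) ^ (2 * d) = 2 ^ d * 2 ^ d" by (simp add: mult_2 power_add)
    also have "\<dots> \<le> sqrt (real n) * sqrt (real n)" using d(1) qle by (intro mult_mono) auto
    also have "\<dots> = real n" using n0 by simp
    finally have "2 powr (2 * real d) \<le> real n" using powr_realpow[of 2 "2 * d"] by simp
    then show ?thesis using n0 unfolding L_def by (simp add: le_log_iff)
  qed
  have l1: "real (l + 1) = 2 ^ d" by (simp add: l_def of_nat_diff)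
  have l_gt: "q / 2 - 1 < real l" using d(2) l1 by simp
  have m_le: "real m \<le> q * L * L / 16" and m_gt: "q * L * L / 16 - 1 < real m"
  proof -
    have "0 \<le> q * L * L / 16" using q256 L by simp
    then show "real m \<le> q * L * L / 16" "q * L * L / 16 - 1 < real m"
      unfolding m_def sq by linarith+
  qed
  have T_le: "real T \<le> q / (128 * K)" and T_gt: "q / (128 * K) - 1 < real T"
  proof -
    have "0 \<le> q / (128 * K)" using q256 K by simp
    then show "real T \<le> q / (128 * K)" "q / (128 * K) - 1 < real T"
      unfolding T_def by linarith+
  qed
  have "q / (128 * K) \<le> q / 128" using K q256 by (intro divide_left_mono) auto
  then have "2 * real T < real l" using T_le l_gt q256 by linarith
  then have T2: "2 * T < l" by linarith
  have dn: "d \<noteq> 0"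
  proof
    assume "d = 0"
    then show False using d(2) q256 by simp
  qed
  have l_pos: "1 \<le> l" using l_gt q256 by linarith
  have path: "2 * d + 1 + 1 \<le> D div 2"
  proof -
    have "real (4 * d + 5) \<le> real D" using dL D(1) L by simp
    then have "4 * d + 5 \<le> D" by linarith
    then show ?thesis by linarith
  qed
  have size: "4 * (m + 1) * (l + 1) + (d + 1) * (l + 1) + (D + 1) \<le> n"
  proof -
    have "real (4 * (m + 1)) * real (l + 1) \<le> (q * L * L / 4 + 4) * q"
      using m_le d(1) l1 q256 L by (intro mult_mono) auto
    moreover have "real (d + 1) * real (l + 1) \<le> (L + 1) * q"
      using dL d(1) l1 q256 L by (intro mult_mono) auto
    moreover have "(q * L * L / 4 + 4) * q = real n / 4 + 4 * q" by (simp add: nq algebra_simps)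
    moreover have "(L + 1) * q = sqrt (real n) + q" by (simp add: sq algebra_simps)
    moreover have "6 * sqrt (real n) + 1 \<le> real n / 4"
    proof -
      have "100 * (q * L) \<le> (q * L) * (q * L)" using qL by (intro mult_right_mono) auto
      then show ?thesis using qL by (simp add: sq nq[symmetric])
    qed
    moreover have "real D \<le> real n / 2" using D(2) by linarith
    ultimately have "real (4 * (m + 1)) * real (l + 1) + real (d + 1) * real (l + 1) + (real D + 1) \<le> real n"
      using qle by linarith
    then have "real (4 * (m + 1) * (l + 1) + (d + 1) * (l + 1) + (D + 1)) \<le> real n"
      by (simp only: of_nat_add of_nat_mult of_nat_1)
    then show ?thesis by linarith
  qed
  have m: "4 * (B + 1) * (d * k) * T + 8 \<le> m"
  proof -
    have "real B \<le> \<beta> * L" using \<beta> L unfolding B_def by simp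
    then have B: "real (B + 1) \<le> (\<beta> + 1) * L" using L by (simp add: algebra_simps)
    have "real (4 * (B + 1) * (d * k) * T) \<le> 4 * ((\<beta> + 1) * L) * (L * real k) * (q / (128 * K))"
      unfolding of_nat_mult
      using B dL T_le \<beta> L by (intro mult_mono) (auto intro!: mult_nonneg_nonneg)
    also have "\<dots> = 4 * L * L * K * (q / (128 * K))" by (simp only: K_def mult_ac)
    also have "\<dots> = q * L * L / 32" using K by simp
    finally have "real (4 * (B + 1) * (d * k) * T) \<le> q * L * L / 32" .
    moreover have "256 * 50 * 50 \<le> q * L * L" using q256 L by (intro mult_mono) auto
    ultimately have "real (4 * (B + 1) * (d * k) * T) + 8 \<le> real m" using m_gt by linarith
    then show ?thesis by linarith
  qed
  then have m1: "1 \<le> m" by linarith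
  have "16 \<le> n"
  proof -
    have "16 * 1 \<le> (q * L) * (q * L)" using qL by (intro mult_mono) auto
    then show ?thesis using nq by linarith
  qed
  then show "enat T \<le> worst_case_rounds c (kecss_inputs k a b) A n D"
    using dn path l_pos size m m1 T2
    by (intro rounds_lower_bound_parameters[OF alg bw k a c, where d=d and m=m and l=l])
      (auto simp: l_def B_def L_def)
  have "1 \<le> q / (256 * K)" using qK K by (simp add: le_divide_eq)
  moreover have "q / (128 * K) = 2 * (q / (256 * K))" by simp
  ultimately have "q / (256 * K) \<le> real T" using T_gt by linarith
  then show "q / (256 * (\<beta> + 1) * real k) \<le> real T" by (simp only: K_def mult.assoc)
qed

lemma rounds_lower_bound_large:
  fixes n :: nat and \<beta> :: real
  defines "L \<equiv> log 2 (real n)"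
  defines "q \<equiv> sqrt (real n) / L"
  assumes alg: "kecss_approx_alg k \<alpha> c (kecss_inputs k a b) A"
    and bw: "respects_bandwidth \<beta> (kecss_inputs k a b) A"
    and k: "1 \<le> k" and a: "1 \<le> a" and c: "1 \<le> c" and \<beta>: "0 < \<beta>"
    and L: "50 \<le> L" and q: "256 * (\<beta> + 1) * real k \<le> q"
    and D: "8 * L \<le> real D" "2 * D \<le> n"
  shows "ereal (1 / (1024 * (\<beta> + 1) * real k) * (real D + q))
    \<le> ereal_of_enat (worst_case_rounds c (kecss_inputs k a b) A n D)"
proof -
  define K where "K = (\<beta> + 1) * real k"
  let ?w = "ereal_of_enat (worst_case_rounds c (kecss_inputs k a b) A n D)"
  have "1 * 1 \<le> (\<beta> + 1) * real k" using \<beta> k by (intro mult_mono) auto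
  then have K: "1 \<le> K" by (simp add: K_def)
  have K1: "1024 * (\<beta> + 1) * real k = 1024 * K" by (simp only: K_def mult.assoc)
  have D400: "400 \<le> D" using L D(1) by linarith
  have "0 \<le> 256 * (\<beta> + 1) * real k" using \<beta> by simp
  then have q0: "0 \<le> q" using q by linarith
  have 1: "ereal (real D / 400) \<le> ?w"
    by (rule rounds_lower_bound_diameter[OF alg bw k a c D400 D(2)])
  have 2: "ereal (q / (256 * K)) \<le> ?w"
    using rounds_lower_bound_sqrt[OF alg bw k a c \<beta> L[unfolded L_def] q[unfolded q_def L_def]
        D(1)[unfolded L_def] D(2)]
    by (simp only: L_def q_def K_def mult.assoc)
  have le: "real D / (1024 * K) \<le> real D / 1024" using K by (intro divide_left_mono) auto
  have eq: "1 / (1024 * (\<beta> + 1) * real k) * (real D + q) = real D / (1024 * K) + q / (256 * K) / 4"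
    unfolding K1 by (simp add: add_divide_distrib)
  have lin: "u + v / 4 \<le> w" if "0 \<le> v" "x / 400 \<le> w" "v \<le> w" "u \<le> x / 1024" for u v w x :: real
    using that by simp
  define M where "M = max (real D / 400) (q / (256 * K))"
  have "0 \<le> q / (256 * K)" using q0 K by simp
  moreover have "real D / 400 \<le> M" "q / (256 * K) \<le> M" by (simp_all add: M_def)
  ultimately have "1 / (1024 * (\<beta> + 1) * real k) * (real D + q) \<le> M"
    unfolding eq using le by (intro lin)
  then have "ereal (1 / (1024 * (\<beta> + 1) * real k) * (real D + q)) \<le> ereal M"
    by simp
  also have "\<dots> \<le> ?w" using 1 2 by (simp add: M_def max_def)
  finally show ?thesis .
qed

theorem theoremA5:
  fixes k a b :: nat and \<alpha> :: "nat \<Rightarrow> real" and \<beta> c :: real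
  assumes "k \<ge> 1" and "a \<ge> 1" and "\<beta> > 0" and "c \<ge> 1"
    and "\<forall>n. \<alpha> n \<ge> 1"
    and "\<exists>p::nat. \<alpha> \<in> O(\<lambda>n. real n ^ p)"
  shows "\<exists>\<epsilon>>0. \<exists>C>0. \<exists>C'>0. \<exists>n0::nat. \<forall>A :: 's congest_alg.
    respects_bandwidth \<beta> (kecss_inputs k a b) A \<and>
    kecss_approx_alg k \<alpha> c (kecss_inputs k a b) A \<longrightarrow>
    (\<forall>n\<ge>n0.
      (\<forall>D::nat. C * log 2 (real n) \<le> real D \<and> 2 * D \<le> n \<longrightarrow>
         ereal (\<epsilon> * (real D + sqrt (real n) / log 2 (real n)))
           \<le> ereal_of_enat (worst_case_rounds c (kecss_inputs k a b) A n D)) \<and>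
      (\<exists>D::nat. real D \<le> C' * log 2 (real n) \<and>
         ereal (\<epsilon> * (real D + sqrt (real n) / log 2 (real n)))
           \<le> ereal_of_enat (worst_case_rounds c (kecss_inputs k a b) A n D)))"
proof -
  define \<epsilon> where "\<epsilon> = 1 / (1024 * (\<beta> + 1) * real k)"
  have "filterlim (\<lambda>n::nat. log 2 (real n)) at_top at_top"
    "filterlim (\<lambda>n::nat. sqrt (real n) / log 2 (real n)) at_top at_top"
    "filterlim (\<lambda>n::nat. real n / log 2 (real n)) at_top at_top"
    by real_asymp+
  then have "\<forall>\<^sub>F n in at_top. 50 \<le> log 2 (real n)
      \<and> 256 * (\<beta> + 1) * real k \<le> sqrt (real n) / log 2 (real n) \<and> 18 \<le> real n / log 2 (real n)"
    unfolding filterlim_at_top by (intro eventually_conj) blast+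
  then obtain n0 where n0: "\<And>n. n \<ge> n0 \<Longrightarrow> 50 \<le> log 2 (real n)"
    "\<And>n. n \<ge> n0 \<Longrightarrow> 256 * (\<beta> + 1) * real k \<le> sqrt (real n) / log 2 (real n)"
    "\<And>n. n \<ge> n0 \<Longrightarrow> 18 \<le> real n / log 2 (real n)"
    unfolding eventually_sequentially by blast
  have main: "ereal (\<epsilon> * (real D + sqrt (real n) / log 2 (real n)))
      \<le> ereal_of_enat (worst_case_rounds c (kecss_inputs k a b) A n D)"
    if "respects_bandwidth \<beta> (kecss_inputs k a b) A" "kecss_approx_alg k \<alpha> c (kecss_inputs k a b) A"
      "n \<ge> n0" "8 * log 2 (real n) \<le> real D" "2 * D \<le> n"
    for A :: "'s congest_alg" and n D
    unfolding \<epsilon>_def using that n0 assms(1-4) by (intro rounds_lower_bound_large) auto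
  have small: "\<exists>D::nat. 8 * log 2 (real n) \<le> real D \<and> real D \<le> 9 * log 2 (real n) \<and> 2 * D \<le> n"
    if n: "n \<ge> n0" for n
  proof -
    define D where "D = nat \<lceil>8 * log 2 (real n)\<rceil>"
    have "8 * log 2 (real n) \<le> real D" "real D \<le> 9 * log 2 (real n)"
      using n0(1)[OF n] unfolding D_def by linarith+
    moreover have "18 * log 2 (real n) \<le> real n"
      using n0(1,3)[OF n] by (simp add: le_divide_eq split: if_splits)
    ultimately show ?thesis by (intro exI[of _ D]) linarith
  qed
  have "\<epsilon> > 0" using assms by (simp add: \<epsilon>_def)
  have "\<forall>A :: 's congest_alg. respects_bandwidth \<beta> (kecss_inputs k a b) A \<and>
      kecss_approx_alg k \<alpha> c (kecss_inputs k a b) A \<longrightarrow>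
    (\<forall>n\<ge>n0.
      (\<forall>D::nat. 8 * log 2 (real n) \<le> real D \<and> 2 * D \<le> n \<longrightarrow>
         ereal (\<epsilon> * (real D + sqrt (real n) / log 2 (real n)))
           \<le> ereal_of_enat (worst_case_rounds c (kecss_inputs k a b) A n D)) \<and>
      (\<exists>D::nat. real D \<le> 9 * log 2 (real n) \<and>
         ereal (\<epsilon> * (real D + sqrt (real n) / log 2 (real n)))
           \<le> ereal_of_enat (worst_case_rounds c (kecss_inputs k a b) A n D)))"
    using main small by meson
  then show ?thesis
    using \<open>\<epsilon> > 0\<close> by (intro exI[of _ \<epsilon>] exI[of _ "8 :: real"] exI[of _ "9 :: real"] exI[of _ n0] conjI) simp_all
qed

end
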